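(* Let $h_3$ be the third Hermite function and let $\mathcal{D}_{\sqrt3}^{-1}h_3(t)=3^{1/4}h_3(\sqrt3\,t)$. Set $x_1=0$, $x_2=\tfrac13$, $x_3=\tfrac12$, $x_4=\tfrac23$, and for $N\in\{2,3,4\}$ let $\Gamma_N=\bigcup_{k=1}^N(\mathbb{Z}+x_k)\subset\mathbb{R}$. Then, for each $N\in\{2,3,4\}$, the Gabor system $\mathcal{G}\left(\mathcal{D}_{\sqrt3}^{-1}h_3,\Gamma_N\times\mathbb{Z}\right)$, whose index set $\Gamma_N\times\mathbb{Z}$ is a semi-regular lattice of density $N$, is not a frame for $L^2(\mathbb{R})$.
   Context: The $n$-th Hermite function is $h_n(t)=(-1)^nC_n e^{\pi t^2}\frac{d^n}{dt^n}\left(e^{-2\pi t^2}\right)$ with $C_n=2^{1/4}/\sqrt{n!(2\pi)^n2^n}$. The unitary dilation is $\mathcal{D}_af(t)=\frac{1}{\sqrt a}f(t/a)$, $a>0$. For $z=(x,\omega)\in\mathbb{R}^2$ the time-frequency shift is $\pi(z)f(t)=e^{2\pi i\omega t}f(t-x)$. For $\Gamma\subset\mathbb{R}^2$, the Gabor system $\mathcal{G}(g,\Gamma)=\{\pi(\gamma)g\mid\gamma\in\Gamma\}$ is a frame for $L^2(\mathbb{R})$ if there are constants $0<A\le B<\infty$ with $A\|f\|_{L^2}^2\le\sum_{\gamma\in\Gamma}|\langle f,\pi(\gamma)g\rangle|^2\le B\|f\|_{L^2}^2$ for all $f\in L^2(\mathbb{R})$. For a lattice $\Lambda\subset\mathbb{R}^2$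 and points $z_1,\dots,z_M$ that are pairwise distinct modulo $\Lambda$, the set $\bigcup_{m=1}^M(\Lambda+z_m)$ has density $M/\mathrm{vol}(\mathbb{R}^2/\Lambda)$. A semi-regular lattice is a set of the form $\Gamma'\times\mathbb{Z}\subset\mathbb{R}^2$ with $\Gamma'\subset\mathbb{R}$. *)

theory Defs
  imports "HOL-Analysis.Analysis"
begin

definition hermite_const :: "nat \<Rightarrow> real" where
  "hermite_const n = 2 powr (1/4) / sqrt (fact n * (2 * pi) ^ n * 2 ^ n)"

definition hermite_fun :: "nat \<Rightarrow> real \<Rightarrow> complex" where
  "hermite_fun n t = complex_of_real ((-1) ^ n * hermite_const n * exp (pi * t\<^sup>2) *
     (deriv ^^ n) (\<lambda>s. exp (- 2 * pi * s\<^sup>2)) t)"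

definition dilation :: "real \<Rightarrow> (real \<Rightarrow> complex) \<Rightarrow> real \<Rightarrow> complex" where
  "dilation a f = (\<lambda>t. complex_of_real (1 / sqrt a) * f (t / a))"

definition tf_shift :: "real \<times> real \<Rightarrow> (real \<Rightarrow> complex) \<Rightarrow> real \<Rightarrow> complex" where
  "tf_shift z f = (\<lambda>t. exp (2 * complex_of_real pi * \<i> * complex_of_real (snd z * t)) * f (t - fst z))"

(* L^2(R) is represented by Borel functions, not by classes modulo null sets; every class has a
   Borel representative, and all notions below depend only on the class. *)
definition L2_real :: "(real \<Rightarrow> complex) set" where
  "L2_real = {f. f \<in> borel_measurable lborel \<and> integrable lborel (\<lambda>t. (cmod (f t))\<^sup>2)}"

definition L2_inner :: "(real \<Rightarrow> complex) \<Rightarrow> (real \<Rightarrow> complex) \<Rightarrow> complex" where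
  "L2_inner f g = (\<integral>t. f t * cnj (g t) \<partial>lborel)"

definition L2_norm :: "(real \<Rightarrow> complex) \<Rightarrow> real" where
  "L2_norm f = sqrt (\<integral>t. (cmod (f t))\<^sup>2 \<partial>lborel)"

(* The sum is taken in ennreal, so that a divergent sum has the value infinity. *)
definition gabor_frame :: "(real \<Rightarrow> complex) \<Rightarrow> (real \<times> real) set \<Rightarrow> bool" where
  "gabor_frame g \<Gamma> \<longleftrightarrow>
     (\<exists>A B :: real. 0 < A \<and> A \<le> B \<and>
        (\<forall>f\<in>L2_real.
           ennreal (A * (L2_norm f)\<^sup>2)
             \<le> (\<Sum>\<^sub>\<infinity>\<gamma>\<in>\<Gamma>. ennreal ((cmod (L2_inner f (tf_shift \<gamma> g)))\<^sup>2)) \<and>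
           (\<Sum>\<^sub>\<infinity>\<gamma>\<in>\<Gamma>. ennreal ((cmod (L2_inner f (tf_shift \<gamma> g)))\<^sup>2))
             \<le> ennreal (B * (L2_norm f)\<^sup>2)))"

definition lattice_basis :: "(real \<times> real) set \<Rightarrow> real \<times> real \<Rightarrow> real \<times> real \<Rightarrow> bool" where
  "lattice_basis \<Lambda> v w \<longleftrightarrow>
     v \<noteq> w \<and> independent {v, w} \<and>
     \<Lambda> = {real_of_int m *\<^sub>R v + real_of_int n *\<^sub>R w | m n. True}"

definition fundamental_cell :: "real \<times> real \<Rightarrow> real \<times> real \<Rightarrow> (real \<times> real) set" where
  "fundamental_cell v w = {s *\<^sub>R v + t *\<^sub>R w | s t. 0 \<le> s \<and> s < 1 \<and> 0 \<le> t \<and> t < 1}"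

(* vol(R^2/Lambda) is the area of the fundamental cell of a basis; it does not depend on the basis. *)
definition has_density :: "(real \<times> real) set \<Rightarrow> real \<Rightarrow> bool" where
  "has_density S d \<longleftrightarrow>
     (\<exists>\<Lambda> v w (M::nat) z.
        lattice_basis \<Lambda> v w \<and>
        (\<forall>i\<in>{1..M}. \<forall>j\<in>{1..M}. i \<noteq> j \<longrightarrow> z i - z j \<notin> \<Lambda>) \<and>
        S = (\<Union>m\<in>{1..M}. (\<lambda>l. l + z m) ` \<Lambda>) \<and>
        d = real M / measure lborel (fundamental_cell v w))"

definition semi_regular_lattice :: "(real \<times> real) set \<Rightarrow> bool" where
  "semi_regular_lattice S \<longleftrightarrow> (\<exists>\<Gamma>'. S = \<Gamma>' \<times> \<int>)"

end

theory Submission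
  imports Defs "HOL-Probability.Probability" "HOL-Real_Asymp.Real_Asymp"
begin

text \<open>
  Integer modulations turn the frame sum over \<open>(\<int> + x) \<times> \<int>\<close> into the squared norms of
  \<open>\<Sum>\<^sub>k f (t + k) g (t + k - l - x)\<close>, summed over \<open>l\<close>. If \<open>f\<close> is the indicator of \<open>K\<close> consecutive
  translates of a short interval \<open>[0, \<delta>]\<close>, these sums are truncations of the periodization
  \<open>G u = \<Sum>\<^sub>k g (u + k)\<close> at \<open>u = t - x\<close>; when \<open>G (- x) = 0\<close> for all shifts \<open>x\<close>, the only contributions
  that do not vanish with \<open>\<delta>\<close> come from the two ends of the window, and they stay bounded as \<open>K\<close> grows
  while the norm of \<open>f\<close> does not. So the lower frame bound fails.

  For the dilated third Hermite function, \<open>G\<close> is odd and 1-periodic, hence vanishes at \<open>0\<close> and \<open>1/2\<close>.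
  Since the Fourier transform of \<open>h\<^sub>3\<close> is \<open>\<i> h\<^sub>3\<close>, Poisson summation at \<open>1/3\<close> yields \<open>G (1/3) = - G (1/3)\<close>: the
  dilation \<open>sqrt 3\<close> makes the dual sum run over the same points \<open>n/3\<close>, and the character
  \<open>sin (2 * pi * n / 3)\<close> selects the residue classes of \<open>\<plusminus>1\<close> modulo 3.
\<close>

subsection \<open>Periodization of exponentially decaying functions\<close>

lemma has_sum_finite_sum:
  fixes f :: "'a \<Rightarrow> 'b \<Rightarrow> 'c::topological_comm_monoid_add"
  assumes "finite L" "\<And>l. l \<in> L \<Longrightarrow> (f l has_sum s l) A"
  shows "((\<lambda>k. \<Sum>l\<in>L. f l k) has_sum (\<Sum>l\<in>L. s l)) A"
  using assms by (induction L rule: finite_induct) (auto intro!: has_sum_add)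

lemma summable_on_exp_minus_abs_int:
  assumes "c > 0"
  shows "(\<lambda>k::int. exp (- c * \<bar>real_of_int k\<bar>)) summable_on UNIV"
proof -
  have "summable (\<lambda>n. exp (- c) ^ n)"
    using assms by (intro summable_geometric) auto
  then have "(\<lambda>n. exp (- c) ^ n) summable_on UNIV"
    by (intro norm_summable_imp_summable_on) auto
  then have n: "(\<lambda>n. exp (- c * real n)) summable_on UNIV"
    by (simp add: exp_of_nat_mult[symmetric] mult.commute)
  have "(\<lambda>k::int. exp (- c * \<bar>real_of_int k\<bar>)) summable_on range int"
    by (subst summable_on_reindex) (use n in \<open>auto simp: o_def\<close>)
  moreover have "(\<lambda>k::int. exp (- c * \<bar>real_of_int k\<bar>)) summable_on range (\<lambda>n. - int n)"
    by (subst summable_on_reindex) (use n in \<open>auto simp: o_def inj_on_def\<close>)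
  ultimately have "(\<lambda>k::int. exp (- c * \<bar>real_of_int k\<bar>)) summable_on (range int \<union> range (\<lambda>n. - int n))"
    by (intro summable_on_union)
  moreover have "range int \<union> range (\<lambda>n. - int n) = UNIV"
    by (auto, metis int_cases2 rangeI)
  ultimately show ?thesis by simp
qed

text \<open>Half of the exponential absorbs the factor \<bar>k\<bar>. This first moment later bounds
  the effect of the two ends of a window, where the translate by \<open>k\<close> is miscounted at
  most 2\<bar>k\<bar> times.\<close>

lemma summable_on_abs_mult_exp_minus_abs_int:
  "(\<lambda>k::int. \<bar>real_of_int k\<bar> * exp (- \<bar>real_of_int k\<bar>)) summable_on UNIV"
proof (rule summable_on_comparison_test)
  show "(\<lambda>k::int. 2 * exp (- (1/2) * \<bar>real_of_int k\<bar>)) summable_on UNIV"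
    by (intro summable_on_cmult_right summable_on_exp_minus_abs_int) auto
next
  fix k :: int
  have "\<bar>real_of_int k\<bar> / 2 \<le> exp (\<bar>real_of_int k\<bar> / 2)"
    using exp_ge_add_one_self[of "\<bar>real_of_int k\<bar> / 2"] by linarith
  then have "\<bar>real_of_int k\<bar> * exp (- \<bar>real_of_int k\<bar>) \<le> 2 * exp (\<bar>real_of_int k\<bar> / 2) * exp (- \<bar>real_of_int k\<bar>)"
    by (intro mult_right_mono) auto
  also have "\<dots> = 2 * exp (- (1/2) * \<bar>real_of_int k\<bar>)"
    by (simp add: exp_add[symmetric])
  finally show "\<bar>real_of_int k\<bar> * exp (- \<bar>real_of_int k\<bar>) \<le> 2 * exp (- (1/2) * \<bar>real_of_int k\<bar>)" .
qed auto

definition periodization :: "(real \<Rightarrow> 'a::banach) \<Rightarrow> real \<Rightarrow> 'a" where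
  "periodization p u = (\<Sum>\<^sub>\<infinity>k. p (u + of_int k))"

text \<open>The rate 1 is a normalisation: every polynomial times a Gaussian satisfies such a bound,
  and the majorant is summable over the integers even with an additional factor
  \<bar>k\<bar>.\<close>

definition exp_decay :: "(real \<Rightarrow> 'a::banach) \<Rightarrow> bool" where
  "exp_decay p \<longleftrightarrow> (\<exists>C. \<forall>t. norm (p t) \<le> C * exp (- \<bar>t\<bar>))"

text \<open>Since \<bar>u + k\<bar> \<ge> \<bar>k\<bar> - R, replacing \<open>u + k\<close> by
  \<open>k\<close> costs only the factor \<open>exp R\<close>. The majorant no longer depends on
  \<open>u\<close>, as the Weierstrass M-test requires.\<close>

lemma exp_decay_shift:
  assumes "exp_decay p"
  obtains C where "C \<ge> 0" "\<And>u k. \<bar>u\<bar> \<le> R \<Longrightarrow> norm (p (u + of_int k)) \<le> C * exp (- \<bar>real_of_int k\<bar>)"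
proof -
  obtain C where C: "\<And>t. norm (p t) \<le> C * exp (- \<bar>t\<bar>)"
    using assms by (auto simp: exp_decay_def)
  have "0 \<le> C" using order_trans[OF norm_ge_zero C[of 0]] by simp
  show ?thesis
  proof (rule that[of "C * exp R"])
    show "0 \<le> C * exp R" using \<open>0 \<le> C\<close> by simp
    fix u k assume u: "\<bar>u\<bar> \<le> R"
    have "norm (p (u + of_int k)) \<le> C * exp (- \<bar>u + of_int k\<bar>)" by (rule C)
    also have "\<dots> \<le> C * exp (R - \<bar>of_int k\<bar>)"
      using u \<open>0 \<le> C\<close> by (intro mult_left_mono) auto
    also have "\<dots> = C * exp R * exp (- \<bar>real_of_int k\<bar>)" by (simp add: exp_diff exp_minus field_simps)
    finally show "norm (p (u + of_int k)) \<le> C * exp R * exp (- \<bar>real_of_int k\<bar>)" .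
  qed
qed

lemma summable_on_of_exp_bound:
  fixes f :: "int \<Rightarrow> 'a::banach"
  assumes "\<And>k. norm (f k) \<le> C * exp (- \<bar>real_of_int k\<bar>)"
  shows "f summable_on UNIV"
proof -
  have "(\<lambda>k::int. C * exp (- \<bar>real_of_int k\<bar>)) summable_on UNIV"
    using summable_on_exp_minus_abs_int[of 1] by (intro summable_on_cmult_right) auto
  then have "(\<lambda>k. norm (f k)) summable_on UNIV"
    by (rule summable_on_comparison_test) (use assms in auto)
  then show "f summable_on UNIV"
    using abs_summable_summable by blast
qed

lemma summable_on_int_translates:
  assumes "exp_decay p"
  shows "(\<lambda>k. p (u + of_int k)) summable_on UNIV"
proof -
  obtain C where "\<And>k. norm (p (u + of_int k)) \<le> C * exp (- \<bar>real_of_int k\<bar>)"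
    using exp_decay_shift[OF assms, of "\<bar>u\<bar>"] by (metis order_refl)
  then show ?thesis by (rule summable_on_of_exp_bound)
qed

lemma uniform_limit_periodization:
  assumes "exp_decay p"
  shows "uniform_limit {-R..R} (\<lambda>X u. \<Sum>k\<in>X. p (u + of_int k)) (periodization p) (finite_subsets_at_top UNIV)"
proof -
  obtain C where C: "\<And>u k. \<bar>u\<bar> \<le> R \<Longrightarrow> norm (p (u + of_int k)) \<le> C * exp (- \<bar>real_of_int k\<bar>)"
    using exp_decay_shift[OF assms] by metis
  have "(\<lambda>k::int. C * exp (- \<bar>real_of_int k\<bar>)) summable_on UNIV"
    using summable_on_exp_minus_abs_int[of 1] by (intro summable_on_cmult_right) auto
  from Weierstrass_m_test_general[OF _ this, of "{-R..R}" "\<lambda>k u. p (u + of_int k)"]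
  show ?thesis unfolding periodization_def[abs_def] using C by force
qed

lemma isCont_periodization:
  assumes "exp_decay p" "continuous_on UNIV p"
  shows "isCont (periodization p) u"
proof -
  have "continuous_on {-(\<bar>u\<bar>+1)..\<bar>u\<bar>+1} (periodization p)"
    by (rule uniform_limit_theorem[OF _ uniform_limit_periodization[OF assms(1)]])
       (auto intro!: always_eventually continuous_intros continuous_on_compose2[OF assms(2)])
  then show ?thesis
    by (rule continuous_on_interior) auto
qed

lemma periodization_add_int:
  "periodization p (u + of_int m) = periodization p u"
proof -
  have "(\<Sum>\<^sub>\<infinity>k. p (u + of_int (m + k))) = (\<Sum>\<^sub>\<infinity>k. p (u + of_int k))"
    by (rule infsum_reindex_bij_betw) (auto intro: bij_betwI[where g = "\<lambda>k. k - m"])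
  then show ?thesis by (simp add: periodization_def algebra_simps)
qed

lemma periodization_minus_of_odd:
  assumes "\<And>t. p (- t) = - p t"
  shows "periodization p (- u) = - periodization p u"
proof -
  have "(\<Sum>\<^sub>\<infinity>k::int. p (- u + of_int (- k))) = (\<Sum>\<^sub>\<infinity>k::int. p (- u + of_int k))"
    by (rule infsum_reindex_bij_betw) (rule bij_uminus)
  moreover have "p (- u + of_int (- k)) = - p (u + of_int k)" for k
    using assms[of "u + of_int k"] by (simp add: algebra_simps)
  ultimately show ?thesis by (simp add: periodization_def infsum_uminus)
qed

text \<open>The two conditions describe the window of length \<open>K\<close> and its translate by
  \<open>-k\<close>. Their symmetric difference lies in two intervals of length \<bar>k\<bar>, one
  at each end, so the bound depends neither on \<open>K\<close> nor on \<open>L\<close>.\<close>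

lemma sum_window_difference:
  assumes "finite L"
  shows "(\<Sum>l\<in>L. \<bar>of_bool (0 \<le> k + l \<and> k + l < K) - of_bool (0 \<le> l \<and> l < K)\<bar> :: real)
    \<le> 2 * \<bar>real_of_int k\<bar>"
proof -
  let ?w = "\<lambda>l. \<bar>of_bool (0 \<le> k + l \<and> k + l < K) - of_bool (0 \<le> l \<and> l < K)\<bar> :: real"
  define D where "D = (if k \<ge> 0 then {-k..<0} \<union> {K-k..<K} else {0..<-k} \<union> {K..<K-k})"
  have "(\<Sum>l\<in>L. ?w l) = (\<Sum>l\<in>L \<inter> D. ?w l)"
    using assms by (intro sum.mono_neutral_right) (auto simp: D_def)
  also have "\<dots> \<le> (\<Sum>l\<in>L \<inter> D. 1)"
    by (intro sum_mono) auto
  also have "\<dots> = real (card (L \<inter> D))" by simp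
  also have "\<dots> \<le> real (card D)"
    by (intro of_nat_mono card_mono) (auto simp: D_def)
  also have "\<dots> \<le> 2 * \<bar>real_of_int k\<bar>"
  proof (cases "k \<ge> 0")
    case True
    have "card D \<le> card {-k..<0} + card {K-k..<K}"
      using True by (simp only: D_def if_True card_Un_le)
    then show ?thesis using True by simp
  next
    case False
    have "card D \<le> card {0..<-k} + card {K..<K-k}"
      using False by (simp only: D_def if_False card_Un_le)
    then show ?thesis using False by simp
  qed
  finally show ?thesis .
qed

text \<open>For \<open>l\<close> inside the window the truncated sum is close to the full
  periodization at \<open>u\<close>, and for \<open>l\<close> outside it is close to 0. Summed over
  \<open>l\<close>, these errors are at most \<open>W\<close>, whatever \<open>K\<close> is, because
  a term at distance \<open>k\<close> is affected for at most 2\<bar>k\<bar> values of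
  \<open>l\<close>. Each truncated sum is bounded by \<open>M\<close>, which turns the sum of
  absolute values into a sum of squares.\<close>

lemma truncated_periodization_square_sum:
  fixes p :: "real \<Rightarrow> 'a::banach"
  assumes "exp_decay p"
  obtains M W where "M \<ge> 0" "W \<ge> 0"
    "\<And>u K L. \<bar>u\<bar> \<le> R \<Longrightarrow> finite L \<Longrightarrow>
       (\<Sum>l\<in>L. (norm (\<Sum>k\<in>{0..<int K}. p (u + of_int k - of_int l)))\<^sup>2)
         \<le> M * (W + real K * norm (periodization p u))"
proof -
  obtain C where "C \<ge> 0"
    and C: "\<And>u k. \<bar>u\<bar> \<le> R \<Longrightarrow> norm (p (u + of_int k)) \<le> C * exp (- \<bar>real_of_int k\<bar>)"
    using exp_decay_shift[OF assms] by metis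
  define b where "b k = C * exp (- \<bar>real_of_int k\<bar>)" for k
  have b0: "b k \<ge> 0" for k using \<open>C \<ge> 0\<close> by (simp add: b_def)
  have bs: "b summable_on UNIV"
    unfolding b_def using summable_on_exp_minus_abs_int[of 1] by (intro summable_on_cmult_right) auto
  have bs2: "(\<lambda>k. 2 * \<bar>real_of_int k\<bar> * b k) summable_on UNIV"
    using summable_on_cmult_right[OF summable_on_abs_mult_exp_minus_abs_int, of "2 * C"]
    by (simp add: b_def algebra_simps)
  define M where "M = (\<Sum>\<^sub>\<infinity>k. b k)"
  define W where "W = (\<Sum>\<^sub>\<infinity>k. 2 * \<bar>real_of_int k\<bar> * b k)"
  have "(\<Sum>l\<in>L. (norm (\<Sum>k\<in>{0..<int K}. p (u + of_int k - of_int l)))\<^sup>2)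
         \<le> M * (W + real K * norm (periodization p u))"
    if u: "\<bar>u\<bar> \<le> R" and L: "finite L" for u K and L :: "int set"
  proof -
    define P where "P l = (\<Sum>k\<in>{0..<int K}. p (u + of_int k - of_int l))" for l :: int
    \<comment> \<open>Shifting the summation index by \<open>l\<close> writes all \<open>P l\<close>
      as sums over the same translates \<open>u + k\<close>; only the window depends on
      \<open>l\<close>.\<close>
    have Pl: "((\<lambda>k. of_bool (0 \<le> k + l \<and> k + l < int K) *\<^sub>R p (u + of_int k)) has_sum P l) UNIV" for l
    proof -
      have "P l = (\<Sum>k\<in>{-l..<int K - l}. p (u + of_int k))"
        unfolding P_def
        by (rule sum.reindex_bij_witness[of _ "\<lambda>k. k + l" "\<lambda>k. k - l"]) (auto simp: algebra_simps)
      then have "((\<lambda>k. p (u + of_int k)) has_sum P l) {-l..<int K - l}"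
        by (intro has_sum_finiteI) auto
      then show ?thesis
        by (subst has_sum_cong_neutral[where T = "{-l..<int K - l}" and g = "\<lambda>k. p (u + of_int k)"]) auto
    qed
    have PM: "norm (P l) \<le> M" for l
      using Pl[of l] has_sum_infsum[OF bs] unfolding M_def
      by (rule norm_infsum_le) (use C u b0 in \<open>auto simp: b_def\<close>)
    define J where "J = {l. 0 \<le> l \<and> l < int K}"
    have G: "((\<lambda>k. p (u + of_int k)) has_sum periodization p u) UNIV"
      unfolding periodization_def by (intro has_sum_infsum summable_on_int_translates assms)
    \<comment> \<open>\<open>w\<close> compares the window of \<open>P l\<close> with the weight
      that counts every translate once if 0 \<le> l < K and not at all otherwise.\<close>
    define w where "w k l = of_bool (0 \<le> k + l \<and> k + l < int K) - (of_bool (0 \<le> l \<and> l < int K) :: real)" for k l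
    have diff: "((\<lambda>k. w k l *\<^sub>R p (u + of_int k)) has_sum
        (P l - of_bool (0 \<le> l \<and> l < int K) *\<^sub>R periodization p u)) UNIV" for l
      using has_sum_add[OF Pl[of l] has_sum_scaleR[OF G, of "- of_bool (0 \<le> l \<and> l < int K)"]]
      by (simp add: w_def algebra_simps)
    have abs_s: "(\<lambda>k. \<bar>w k l\<bar> * b k) summable_on UNIV" for l
      by (rule summable_on_comparison_test[OF bs]) (use b0 in \<open>auto simp: w_def\<close>)
    have "(\<Sum>l\<in>L. norm (P l - of_bool (0 \<le> l \<and> l < int K) *\<^sub>R periodization p u))
        \<le> (\<Sum>l\<in>L. \<Sum>\<^sub>\<infinity>k. \<bar>w k l\<bar> * b k)"
    proof (rule sum_mono)
      fix l
      show "norm (P l - of_bool (0 \<le> l \<and> l < int K) *\<^sub>R periodization p u) \<le> (\<Sum>\<^sub>\<infinity>k. \<bar>w k l\<bar> * b k)"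
        using diff[of l] has_sum_infsum[OF abs_s[of l]]
        by (rule norm_infsum_le) (use C u in \<open>auto simp: b_def intro!: mult_left_mono\<close>)
    qed
    \<comment> \<open>Interchanging the sums puts the finite sum over \<open>l\<close> inside, where
      the window estimate applies for each fixed \<open>k\<close>.\<close>
    also have "\<dots> \<le> W"
      unfolding W_def using has_sum_finite_sum[OF L has_sum_infsum[OF abs_s]] has_sum_infsum[OF bs2]
    proof (rule has_sum_mono)
      fix k
      have "(\<Sum>l\<in>L. \<bar>w k l\<bar> * b k) = (\<Sum>l\<in>L. \<bar>w k l\<bar>) * b k"
        by (simp add: sum_distrib_right)
      also have "\<dots> \<le> 2 * \<bar>real_of_int k\<bar> * b k"
        unfolding w_def using L b0 by (intro mult_right_mono sum_window_difference)
      finally show "(\<Sum>l\<in>L. \<bar>w k l\<bar> * b k) \<le> 2 * \<bar>real_of_int k\<bar> * b k" .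
    qed
    finally have 1: "(\<Sum>l\<in>L. norm (P l - of_bool (0 \<le> l \<and> l < int K) *\<^sub>R periodization p u)) \<le> W" .
    have "(\<Sum>l\<in>L. norm (of_bool (0 \<le> l \<and> l < int K) *\<^sub>R periodization p u))
        = (\<Sum>l\<in>L \<inter> {0..<int K}. norm (periodization p u))"
      using L by (intro sum.mono_neutral_cong_right) auto
    also have "\<dots> \<le> real K * norm (periodization p u)"
      using card_mono[of "{0..<int K}" "L \<inter> {0..<int K}"] by (auto intro!: mult_right_mono)
    finally have 2: "(\<Sum>l\<in>L. norm (of_bool (0 \<le> l \<and> l < int K) *\<^sub>R periodization p u))
        \<le> real K * norm (periodization p u)" .
    \<comment> \<open>The squared l^2 norm is at most the supremum times the l^1 norm; the l^1 norm
      splits into the error part and the part of the full periodization.\<close>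
    have "(\<Sum>l\<in>L. (norm (P l))\<^sup>2) \<le> (\<Sum>l\<in>L. M * norm (P l))"
      by (intro sum_mono) (auto simp: power2_eq_square PM intro!: mult_right_mono)
    also have "\<dots> = M * (\<Sum>l\<in>L. norm (P l))" by (simp add: sum_distrib_left)
    also have "\<dots> \<le> M * ((\<Sum>l\<in>L. norm (P l - of_bool (0 \<le> l \<and> l < int K) *\<^sub>R periodization p u))
        + (\<Sum>l\<in>L. norm (of_bool (0 \<le> l \<and> l < int K) *\<^sub>R periodization p u)))"
      unfolding sum.distrib[symmetric] using order_trans[OF norm_ge_zero PM]
      by (intro mult_left_mono sum_mono) (metis diff_add_cancel norm_triangle_ineq)
    also have "\<dots> \<le> M * (W + real K * norm (periodization p u))"
      using 1 2 order_trans[OF norm_ge_zero PM] by (intro mult_left_mono) auto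
    finally show ?thesis by (simp add: P_def)
  qed
  moreover have "M \<ge> 0" "W \<ge> 0" using b0 by (auto simp: M_def W_def intro!: infsum_nonneg)
  ultimately show ?thesis using that by blast
qed

subsection \<open>Vanishing periodizations and Gabor frames\<close>

lemma integrable_bounded_support:
  fixes f :: "real \<Rightarrow> 'a::{banach, second_countable_topology}"
  assumes "f \<in> borel_measurable borel" "\<And>t. t \<in> {a..b} \<Longrightarrow> norm (f t) \<le> B" "\<And>t. t \<notin> {a..b} \<Longrightarrow> f t = 0"
  shows "integrable lborel f"
proof (rule Bochner_Integration.integrable_bound)
  show "integrable lborel (\<lambda>t. B * indicator {a..b} t)"
    by (intro integrable_mult_right integrable_real_indicator) (auto simp: emeasure_lborel_Icc_eq)
  show "AE t in lborel. norm (f t) \<le> norm (B * indicator {a..b} t)"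
    using assms(2,3) by (intro AE_I2) (force simp: indicator_def)
qed (use assms in auto)

section \<open>Bessel's inequality for the integer exponentials\<close>

lemma borel_measurable_cnj [measurable (raw)]:
  "f \<in> borel_measurable M \<Longrightarrow> (\<lambda>x. cnj (f x)) \<in> borel_measurable M"
  by (rule borel_measurable_continuous_on[of cnj]) (auto intro: continuous_intros)

text \<open>The factor is written in the shape used by \<open>tf_shift\<close>, so that unfolding
  identifies modulation by the integer \<open>n\<close> with multiplication by
  \<open>expi n\<close>.\<close>

definition expi :: "int \<Rightarrow> real \<Rightarrow> complex" where
  "expi n t = exp (2 * complex_of_real pi * \<i> * complex_of_real (of_int n * t))"

lemma norm_expi [simp]: "norm (expi n t) = 1"
  by (simp add: expi_def norm_exp_eq_Re)

lemma expi_mult_cnj: "expi n t * cnj (expi m t) = expi (n - m) t"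
  by (simp add: expi_def exp_cnj exp_add[symmetric] algebra_simps)

lemma expi_0 [simp]: "expi 0 t = 1"
  by (simp add: expi_def)

lemma expi_add_int: "expi n (t + of_int k) = expi n t"
proof -
  have "expi n (t + of_int k) = expi n t * exp (2 * of_int (n * k) * of_real pi * \<i>)"
    by (simp add: expi_def exp_add[symmetric] algebra_simps)
  also have "exp (2 * of_int (n * k) * of_real pi * \<i>) = 1"
    using exp_integer_2pi[of "of_int (n * k)"] by (simp add: algebra_simps)
  finally show ?thesis by simp
qed

lemma continuous_on_expi [continuous_intros]: 
  "continuous_on A f \<Longrightarrow> continuous_on A (\<lambda>t. expi n (f t))"
  unfolding expi_def by (intro continuous_intros)

lemma borel_measurable_expi [measurable]: "expi n \<in> borel_measurable borel"
  by (intro borel_measurable_continuous_onI continuous_intros)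

lemma integral_expi: "(\<integral>t. indicator {0..1} t *\<^sub>R expi n t \<partial>lborel) = of_bool (n = 0)"
proof (cases "n = 0")
  case False
  define F where "F t = expi n t / (2 * of_real pi * \<i> * of_int n)" for t
  have "(\<integral>t. indicator {0..1} t *\<^sub>R expi n t \<partial>lborel) = F 1 - F 0"
  proof (rule integral_FTC_atLeastAtMost)
    fix t :: real
    have "((\<lambda>z. exp (2 * complex_of_real pi * \<i> * of_int n * z) / (2 * of_real pi * \<i> * of_int n))
      has_field_derivative exp (2 * complex_of_real pi * \<i> * of_int n * of_real t)) (at (of_real t))"
      using False by (auto intro!: derivative_eq_intros)
    from has_vector_derivative_real_field[OF this]
    show "(F has_vector_derivative expi n t) (at t within {0..1})"
      by (simp add: F_def[abs_def] expi_def algebra_simps)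
  qed (auto intro!: continuous_intros)
  also have "\<dots> = 0"
    using expi_add_int[of n 0 1] by (simp add: F_def)
  finally show ?thesis using False by simp
qed simp

text \<open>With \<open>S\<close> the orthogonal projection of \<phi> onto the span of the
  exponentials from \<open>F\<close> on the unit interval, the nonnegative integral of the squared
  distance between \<phi> and \<open>S\<close> expands to the right side minus the left side. Both
  mixed products and the square of \<open>S\<close> integrate to the same sum of squared
  coefficients.\<close>

lemma bessel_inequality_expi:
  fixes \<phi> :: "real \<Rightarrow> complex"
  assumes [measurable]: "\<phi> \<in> borel_measurable borel"
    and bound: "\<And>t. norm (\<phi> t) \<le> B" and supp: "\<And>t. t \<notin> {0..1} \<Longrightarrow> \<phi> t = 0"
    and "finite F"
  shows "(\<Sum>n\<in>F. (norm (\<integral>t. \<phi> t * cnj (expi n t) \<partial>lborel))\<^sup>2) \<le> (\<integral>t. (norm (\<phi> t))\<^sup>2 \<partial>lborel)"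
proof -
  define a where "a n = (\<integral>t. \<phi> t * cnj (expi n t) \<partial>lborel)" for n
  define S where "S t = indicator {0..1} t *\<^sub>R (\<Sum>n\<in>F. a n * expi n t)" for t
  have S[measurable]: "S \<in> borel_measurable borel"
    unfolding S_def[abs_def] by measurable
  define D where "D = (\<Sum>n\<in>F. norm (a n))"
  have SB: "norm (S t) \<le> D" for t
  proof -
    have "norm (S t) \<le> norm (\<Sum>n\<in>F. a n * expi n t)" by (simp add: S_def indicator_def)
    also have "\<dots> \<le> D"
      unfolding D_def by (rule sum_norm_le) (simp add: norm_mult)
    finally show ?thesis .
  qed
  have B0: "0 \<le> B" "0 \<le> D" using order_trans[OF norm_ge_zero bound] order_trans[OF norm_ge_zero SB] by auto
  have S0: "S t = 0" if "t \<notin> {0..1}" for t using that by (simp add: S_def)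
  have I: "integrable lborel (\<lambda>t. f t * cnj (g t))"
    if [measurable]: "f \<in> borel_measurable borel" "g \<in> borel_measurable borel"
      and "\<And>t. norm (f t) \<le> B1" "\<And>t. norm (g t) \<le> B2" "\<And>t. t \<notin> {0..1} \<Longrightarrow> f t = 0 \<or> g t = 0"
    for f g :: "real \<Rightarrow> complex" and B1 B2
  proof (rule integrable_bounded_support[where B = "B1 * B2"])
    fix t
    show "norm (f t * cnj (g t)) \<le> B1 * B2"
      unfolding norm_mult complex_mod_cnj using that(3)[of t] 
      by (intro mult_mono that(3,4)) (auto intro: order_trans[OF norm_ge_zero])
  next
    fix t :: real assume "t \<notin> {0..1}"
    then show "f t * cnj (g t) = 0" using that(5) by auto
  qed measurable
  note int = I[OF \<open>\<phi> \<in> _\<close> \<open>\<phi> \<in> _\<close> bound bound] I[OF \<open>\<phi> \<in> _\<close> S bound SB] I[OF S \<open>\<phi> \<in> _\<close> SB bound] I[OF S S SB SB]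
  have 1: "(\<integral>t. \<phi> t * cnj (S t) \<partial>lborel) = (\<Sum>n\<in>F. of_real ((norm (a n))\<^sup>2))"
  proof -
    have "(\<integral>t. \<phi> t * cnj (S t) \<partial>lborel) = (\<integral>t. (\<Sum>n\<in>F. cnj (a n) * (\<phi> t * cnj (expi n t))) \<partial>lborel)"
      by (intro Bochner_Integration.integral_cong refl)
        (use supp in \<open>force simp: S_def sum_distrib_left indicator_def algebra_simps intro!: sum.cong\<close>)
    also have "\<dots> = (\<Sum>n\<in>F. \<integral>t. cnj (a n) * (\<phi> t * cnj (expi n t)) \<partial>lborel)"
      by (intro Bochner_Integration.integral_sum integrable_mult_right I[where ?B1.0 = B and ?B2.0 = 1])
        (use bound supp in auto)
    also have "\<dots> = (\<Sum>n\<in>F. cnj (a n) * a n)"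
      by (simp add: a_def)
    finally show ?thesis by (simp add: complex_norm_square mult.commute del: of_real_power)
  qed
  have 2: "(\<integral>t. S t * cnj (\<phi> t) \<partial>lborel) = (\<Sum>n\<in>F. of_real ((norm (a n))\<^sup>2))"
  proof -
    have "(\<integral>t. S t * cnj (\<phi> t) \<partial>lborel) = cnj (\<integral>t. \<phi> t * cnj (S t) \<partial>lborel)"
      unfolding Bochner_Integration.integral_cnj[symmetric] by (simp add: mult.commute)
    then show ?thesis by (simp add: 1)
  qed
  have 3: "(\<integral>t. S t * cnj (S t) \<partial>lborel) = (\<Sum>n\<in>F. of_real ((norm (a n))\<^sup>2))"
  proof -
    have "(\<integral>t. S t * cnj (S t) \<partial>lborel) =
      (\<integral>t. (\<Sum>n\<in>F. \<Sum>m\<in>F. a n * cnj (a m) * (indicator {0..1} t *\<^sub>R expi (n - m) t)) \<partial>lborel)"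
      by (intro Bochner_Integration.integral_cong refl)
        (auto simp: S_def sum_product indicator_def expi_mult_cnj[symmetric] algebra_simps intro!: sum.cong)
    also have "\<dots> = (\<Sum>n\<in>F. \<Sum>m\<in>F. \<integral>t. a n * cnj (a m) * (indicator {0..1} t *\<^sub>R expi (n - m) t) \<partial>lborel)"
      by (subst Bochner_Integration.integral_sum, intro Bochner_Integration.integrable_sum, rule integrable_mult_right,
          rule integrable_bounded_support[where B = 1 and a = 0 and b = 1], (auto)[3],
          intro sum.cong refl Bochner_Integration.integral_sum, rule integrable_mult_right,
          rule integrable_bounded_support[where B = 1 and a = 0 and b = 1]) auto
    also have "\<dots> = (\<Sum>n\<in>F. \<Sum>m\<in>F. a n * cnj (a m) * of_bool (n - m = 0))"
      by (simp only: integral_mult_right_zero integral_expi)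
    also have "\<dots> = (\<Sum>n\<in>F. \<Sum>m\<in>F. if n = m then a n * cnj (a m) else 0)"
      by (intro sum.cong) auto
    also have "\<dots> = (\<Sum>n\<in>F. a n * cnj (a n))"
      using \<open>finite F\<close> by (simp add: sum.delta)
    finally show ?thesis by (simp add: complex_norm_square del: of_real_power)
  qed
  have "complex_of_real (\<integral>t. (norm (\<phi> t - S t))\<^sup>2 \<partial>lborel) = 
     (\<integral>t. complex_of_real ((norm (\<phi> t - S t))\<^sup>2) \<partial>lborel)"
    by (rule integral_complex_of_real[symmetric])
  also have "\<dots> = (\<integral>t. \<phi> t * cnj (\<phi> t) - \<phi> t * cnj (S t) - S t * cnj (\<phi> t) + S t * cnj (S t) \<partial>lborel)"
    unfolding complex_norm_square 
    by (intro Bochner_Integration.integral_cong refl) (simp add: algebra_simps)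
  also have "\<dots> = (\<integral>t. \<phi> t * cnj (\<phi> t) \<partial>lborel) - (\<Sum>n\<in>F. of_real ((norm (a n))\<^sup>2))"
    using int supp S0 by (simp add: 1 2 3)
  also have "\<dots> = of_real ((\<integral>t. (norm (\<phi> t))\<^sup>2 \<partial>lborel) - (\<Sum>n\<in>F. (norm (a n))\<^sup>2))"
    unfolding complex_norm_square[symmetric] integral_complex_of_real by simp
  finally have "(\<integral>t. (norm (\<phi> t - S t))\<^sup>2 \<partial>lborel) = (\<integral>t. (norm (\<phi> t))\<^sup>2 \<partial>lborel) - (\<Sum>n\<in>F. (norm (a n))\<^sup>2)"
    unfolding of_real_eq_iff .
  moreover have "0 \<le> (\<integral>t. (norm (\<phi> t - S t))\<^sup>2 \<partial>lborel)" by simp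
  ultimately show ?thesis by (simp add: a_def)
qed

text \<open>Each translate of the interval is moved back to [0, \<delta>]. The modulation by an
  integer frequency is 1-periodic and hence common to all \<open>K\<close> pieces, so the inner
  product becomes a Fourier coefficient of a truncated periodization.\<close>

lemma L2_inner_window_tf_shift:
  fixes g :: "real \<Rightarrow> complex" and \<delta> :: real
  assumes cont: "continuous_on UNIV g"
  shows "L2_inner (\<lambda>t. \<Sum>k\<in>{0..<int K}. indicator {0..\<delta>} (t - of_int k)) (tf_shift (x, of_int n) g)
    = (\<integral>t. indicator {0..\<delta>} t *\<^sub>R cnj (\<Sum>k\<in>{0..<int K}. g (t + of_int k - x)) * cnj (expi n t) \<partial>lborel)"
proof -
  have g[measurable]: "g \<in> borel_measurable borel"
    using cont by (rule borel_measurable_continuous_onI)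
  define q where "q t = cnj (expi n t) * cnj (g (t - x))" for t
  have q[measurable]: "q \<in> borel_measurable borel"
    unfolding q_def[abs_def] by measurable
  have qc: "continuous_on UNIV q"
    unfolding q_def[abs_def] by (intro continuous_intros continuous_on_compose2[OF cont]) auto
  have int0: "integrable lborel (\<lambda>t. indicator {0..\<delta>} t * q (t + of_int k))" for k
  proof -
    have "compact ((\<lambda>t. q (t + of_int k)) ` {0..\<delta>})"
      by (intro compact_continuous_image continuous_intros continuous_on_compose2[OF qc]) auto
    then obtain B where "\<forall>y\<in>(\<lambda>t. q (t + of_int k)) ` {0..\<delta>}. norm y \<le> B"
      using compact_imp_bounded bounded_iff by blast
    then show ?thesis
      by (intro integrable_bounded_support[where a = 0 and b = \<delta> and B = B]) (auto simp: indicator_def)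
  qed
  have int1: "integrable lborel (\<lambda>t. indicator {0..\<delta>} (t - of_int k) * q t)" for k
    using lborel_integrable_real_affine[OF int0[of k], of 1 "- of_int k"] by (simp add: algebra_simps)
  have "L2_inner (\<lambda>t. \<Sum>k\<in>{0..<int K}. indicator {0..\<delta>} (t - of_int k)) (tf_shift (x, of_int n) g)
    = (\<integral>t. (\<Sum>k\<in>{0..<int K}. indicator {0..\<delta>} (t - of_int k) * q t) \<partial>lborel)"
    by (simp add: L2_inner_def tf_shift_def q_def expi_def sum_distrib_right)
  also have "\<dots> = (\<Sum>k\<in>{0..<int K}. \<integral>t. indicator {0..\<delta>} (t - of_int k) * q t \<partial>lborel)"
    by (intro Bochner_Integration.integral_sum int1)
  also have "\<dots> = (\<Sum>k\<in>{0..<int K}. \<integral>t. indicator {0..\<delta>} t * q (t + of_int k) \<partial>lborel)"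
  proof (rule sum.cong)
    fix k
    show "(\<integral>t. indicator {0..\<delta>} (t - of_int k) * q t \<partial>lborel) = (\<integral>t. indicator {0..\<delta>} t * q (t + of_int k) \<partial>lborel)"
      using lborel_integral_real_affine[of 1 "\<lambda>t. indicator {0..\<delta>} (t - of_int k) * q t" "of_int k"]
      by (simp add: algebra_simps)
  qed auto
  also have "\<dots> = (\<integral>t. (\<Sum>k\<in>{0..<int K}. indicator {0..\<delta>} t * q (t + of_int k)) \<partial>lborel)"
    by (intro Bochner_Integration.integral_sum[symmetric] int0)
  also have "\<dots> = (\<integral>t. indicator {0..\<delta>} t *\<^sub>R cnj (\<Sum>k\<in>{0..<int K}. g (t + of_int k - x)) * cnj (expi n t) \<partial>lborel)"
    by (intro Bochner_Integration.integral_cong refl)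
      (simp add: q_def expi_add_int sum_distrib_left indicator_def mult.commute)
  finally show ?thesis .
qed

text \<open>The function \<open>r\<close> counts the intervals that contain \<open>t\<close>. As a
  nonnegative integer it is at most its square, so overlaps, such as the shared end points at
  \<delta> = 1, can only raise the norm above the total length of the intervals.\<close>

lemma L2_window:
  fixes \<delta> :: real and K :: nat
  assumes "0 \<le> \<delta>"
  defines "f \<equiv> (\<lambda>t. \<Sum>k\<in>{0..<int K}. indicator {0..\<delta>} (t - of_int k) :: complex)"
  shows "f \<in> L2_real" "real K * \<delta> \<le> (L2_norm f)\<^sup>2"
proof -
  define r where "r t = (\<Sum>k\<in>{0..<int K}. indicator {of_int k..of_int k + \<delta>} t :: real)" for t
  have fr: "f t = of_real (r t)" for t
    unfolding f_def r_def of_real_sum by (intro sum.cong) (auto simp: indicator_def)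
  have r0: "0 \<le> r t" for t unfolding r_def by (intro sum_nonneg) auto
  have rK: "r t \<le> real K" for t
    unfolding r_def by (rule order_trans[OF sum_mono[where g = "\<lambda>_. 1"]]) (auto simp: indicator_def)
  have rsq: "r t \<le> (r t)\<^sup>2" for t
  proof -
    have "r t = of_int (\<Sum>k\<in>{0..<int K}. indicator {of_int k..of_int k + \<delta>} t :: int)"
      unfolding r_def of_int_sum by (intro sum.cong) (auto simp: indicator_def)
    then obtain j :: int where j: "r t = of_int j" by blast
    then have "0 \<le> j" using r0[of t] by simp
    then have "j \<le> j\<^sup>2" by (cases "j = 0") (auto simp: power2_eq_square)
    then show ?thesis unfolding j by (metis of_int_le_iff of_int_power)
  qed
  have [measurable]: "r \<in> borel_measurable borel"
    unfolding r_def[abs_def] by measurable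
  have rz: "r t = 0" if "t \<notin> {0..real K + \<delta>}" for t
  proof -
    have "t \<in> {0..real K + \<delta>}" if "k \<in> {0..<int K}" "t \<in> {of_int k..of_int k + \<delta>}" for k
    proof -
      have "0 \<le> real_of_int k" "real_of_int k \<le> real K" using that(1) by auto
      then show ?thesis using that(2) by auto
    qed
    then show ?thesis using that unfolding r_def by (intro sum.neutral) (auto simp: indicator_def)
  qed
  have int2: "integrable lborel (\<lambda>t. (r t)\<^sup>2)"
    using rz r0 rK by (intro integrable_bounded_support[where a = 0 and b = "real K + \<delta>" and B = "(real K)\<^sup>2"])
      (auto intro!: power_mono)
  show "f \<in> L2_real"
    using int2 by (simp add: L2_real_def fr[abs_def])
  have "real K * \<delta> = (\<Sum>k\<in>{0..<int K}. \<integral>t. indicator {of_int k..of_int k + \<delta>} t \<partial>lborel)"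
    using assms(1) by simp
  also have "\<dots> = (\<integral>t. r t \<partial>lborel)"
    unfolding r_def by (intro Bochner_Integration.integral_sum[symmetric] integrable_real_indicator)
      (auto simp: emeasure_lborel_Icc_eq)
  also have "\<dots> \<le> (\<integral>t. (r t)\<^sup>2 \<partial>lborel)"
    using rz r0 rK rsq by (intro integral_mono int2 integrable_bounded_support[where a = 0 and b = "real K + \<delta>" and B = "real K"])
      (auto)
  also have "\<dots> = (L2_norm f)\<^sup>2"
    by (simp add: L2_norm_def fr)
  finally show "real K * \<delta> \<le> (L2_norm f)\<^sup>2" .
qed

text \<open>For fixed \<open>x\<close> and \<open>l\<close>, Bessel's inequality bounds the sum over
  the frequencies by the integral of a squared truncated periodization over [0, \<delta>]. The sum
  over \<open>l\<close> is then taken under the integral, where it is at most \<open>Q\<close>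
  pointwise, which leaves the factor \<delta>.\<close>

lemma gabor_window_sum_bound:
  fixes g :: "real \<Rightarrow> complex" and X :: "real set" and \<delta> :: real and K :: nat
  assumes cont: "continuous_on UNIV g" and "finite X" "0 \<le> \<delta>" "\<delta> \<le> 1"
    and bound: "\<And>t x L. t \<in> {0..\<delta>} \<Longrightarrow> x \<in> X \<Longrightarrow> finite L \<Longrightarrow>
       (\<Sum>l\<in>L. (norm (\<Sum>k\<in>{0..<int K}. g (t - x + of_int k - of_int l)))\<^sup>2) \<le> Q"
  defines "f \<equiv> (\<lambda>t. \<Sum>k\<in>{0..<int K}. indicator {0..\<delta>} (t - of_int k) :: complex)"
  shows "(\<Sum>\<^sub>\<infinity>\<gamma>\<in>(\<Union>x\<in>X. (\<lambda>m. m + x) ` \<int>) \<times> \<int>. ennreal ((cmod (L2_inner f (tf_shift \<gamma> g)))\<^sup>2))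
    \<le> ennreal (real (card X) * (\<delta> * Q))"
proof (rule infsum_le_finite_sums)
  fix F :: "(real \<times> real) set" assume F: "finite F" "F \<subseteq> (\<Union>x\<in>X. (\<lambda>m. m + x) ` \<int>) \<times> \<int>"
  define P where "P x t = (\<Sum>k\<in>{0..<int K}. g (t + of_int k - x))" for x t
  have g[measurable]: "g \<in> borel_measurable borel"
    using cont by (rule borel_measurable_continuous_onI)
  have P[measurable]: "P x \<in> borel_measurable borel" for x
    unfolding P_def[abs_def] by measurable
  have Pc: "continuous_on A (P x)" for x A
    unfolding P_def[abs_def] by (intro continuous_intros continuous_on_compose2[OF cont]) auto
  have PB: "\<exists>B\<ge>0. \<forall>t\<in>{0..\<delta>}. norm (P x t) \<le> B" for x
  proof -
    have "compact (P x ` {0..\<delta>})" by (intro compact_continuous_image Pc) auto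
    then obtain B where "\<forall>y\<in>P x ` {0..\<delta>}. norm y \<le> B"
      using compact_imp_bounded bounded_iff by blast
    then show ?thesis by (intro exI[of _ "max B 0"]) (auto simp: le_max_iff_disj)
  qed
  define h where "h z = (case z of ((x, l), n) \<Rightarrow> (of_int l + x, real_of_int n))"
    for z :: "(real \<times> int) \<times> int" 
  have sub: "F \<subseteq> h ` ((X \<times> UNIV) \<times> UNIV)"
  proof
    fix z assume "z \<in> F"
    then obtain x l n where "x \<in> X" "z = (of_int l + x, of_int n)"
      using F(2) by (auto elim!: Ints_cases)
    then show "z \<in> h ` ((X \<times> UNIV) \<times> UNIV)"
      by (intro image_eqI[of _ _ "((x, l), n)"]) (auto simp: h_def)
  qed
  \<comment> \<open>A finite preimage \<open>C\<close> of \<open>F\<close> is enlarged to a box of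
    shifts, translations and frequencies. The map \<open>h\<close> fails to be injective when two
    points of \<open>X\<close> differ by an integer; such repetitions only increase a sum of
    nonnegative terms.\<close>
  obtain C where C: "C \<subseteq> (X \<times> UNIV) \<times> UNIV" "finite C" "F = h ` C"
    using finite_subset_image[OF F(1) sub] by blast
  define L where "L = (\<lambda>z. snd (fst z)) ` C"
  define N where "N = snd ` C"
  have fin: "finite L" "finite N" using C(2) by (auto simp: L_def N_def)
  have CLN: "C \<subseteq> (X \<times> L) \<times> N" using C(1) by (force simp: L_def N_def)
  define I where "I z = (cmod (L2_inner f (tf_shift z g)))\<^sup>2" for z
  have "(\<Sum>\<gamma>\<in>F. I \<gamma>) \<le> (\<Sum>z\<in>C. I (h z))"
    unfolding C(3) using sum_image_le[OF C(2), of I h] by (simp add: I_def)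
  also have "\<dots> \<le> (\<Sum>z\<in>(X \<times> L) \<times> N. I (h z))"
    using CLN fin assms(2) by (intro sum_mono2) (auto simp: I_def)
  also have "\<dots> = (\<Sum>x\<in>X. \<Sum>l\<in>L. \<Sum>n\<in>N. I (of_int l + x, of_int n))"
  proof -
    have "(\<Sum>z\<in>(X \<times> L) \<times> N. I (h z)) = (\<Sum>p\<in>X \<times> L. \<Sum>n\<in>N. I (h (p, n)))"
      using sum.cartesian_product[of "\<lambda>p n. I (h (p, n))" N "X \<times> L"] by (simp add: case_prod_unfold)
    also have "\<dots> = (\<Sum>x\<in>X. \<Sum>l\<in>L. \<Sum>n\<in>N. I (h ((x, l), n)))"
      using sum.cartesian_product[of "\<lambda>x l. \<Sum>n\<in>N. I (h ((x, l), n))" L X] by (simp add: case_prod_unfold)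
    finally show ?thesis by (simp add: h_def)
  qed
  also have "\<dots> \<le> (\<Sum>x\<in>X. \<Sum>l\<in>L. \<integral>t. indicator {0..\<delta>} t * (norm (P (of_int l + x) t))\<^sup>2 \<partial>lborel)"
  proof (intro sum_mono)
    fix x l
    define \<phi> where "\<phi> t = indicator {0..\<delta>} t *\<^sub>R cnj (P (of_int l + x) t)" for t
    obtain B where B: "B \<ge> 0" "\<And>t. t \<in> {0..\<delta>} \<Longrightarrow> norm (P (of_int l + x) t) \<le> B"
      using PB[of "of_int l + x"] by blast
    have "(\<Sum>n\<in>N. I (of_int l + x, of_int n)) = (\<Sum>n\<in>N. (norm (\<integral>t. \<phi> t * cnj (expi n t) \<partial>lborel))\<^sup>2)"
      unfolding I_def f_def L2_inner_window_tf_shift[OF cont] \<phi>_def P_def ..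
    also have "\<dots> \<le> (\<integral>t. (norm (\<phi> t))\<^sup>2 \<partial>lborel)"
      using B \<open>\<delta> \<le> 1\<close> fin
      by (intro bessel_inequality_expi[where B = B]) (auto simp: \<phi>_def[abs_def] indicator_def)
    also have "\<dots> = (\<integral>t. indicator {0..\<delta>} t * (norm (P (of_int l + x) t))\<^sup>2 \<partial>lborel)"
      by (intro Bochner_Integration.integral_cong refl) (auto simp: \<phi>_def indicator_def)
    finally show "(\<Sum>n\<in>N. I (of_int l + x, of_int n))
      \<le> (\<integral>t. indicator {0..\<delta>} t * (norm (P (of_int l + x) t))\<^sup>2 \<partial>lborel)" .
  qed
  also have "\<dots> \<le> (\<Sum>x\<in>X. \<delta> * Q)"
  proof (rule sum_mono)
    fix x assume x: "x \<in> X"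
    have int: "integrable lborel (\<lambda>t. indicator {0..\<delta>} t * (norm (P (of_int l + x) t))\<^sup>2)" for l
    proof -
      obtain B where "B \<ge> 0" "\<And>t. t \<in> {0..\<delta>} \<Longrightarrow> norm (P (of_int l + x) t) \<le> B"
        using PB[of "of_int l + x"] by blast
      then show ?thesis
        by (intro integrable_bounded_support[where a = 0 and b = \<delta> and B = "B\<^sup>2"]) (auto intro!: power_mono)
    qed
    have "(\<Sum>l\<in>L. \<integral>t. indicator {0..\<delta>} t * (norm (P (of_int l + x) t))\<^sup>2 \<partial>lborel)
      = (\<integral>t. (\<Sum>l\<in>L. indicator {0..\<delta>} t * (norm (P (of_int l + x) t))\<^sup>2) \<partial>lborel)"
      by (intro Bochner_Integration.integral_sum[symmetric] int)
    also have "\<dots> \<le> (\<integral>t. indicator {0..\<delta>} t * Q \<partial>lborel)"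
    proof (rule integral_mono)
      show "integrable lborel (\<lambda>t. indicator {0..\<delta>} t * Q)"
        by (intro integrable_mult_left integrable_real_indicator) (auto simp: emeasure_lborel_Icc_eq)
      fix t
      show "(\<Sum>l\<in>L. indicator {0..\<delta>} t * (norm (P (of_int l + x) t))\<^sup>2) \<le> indicator {0..\<delta>} t * Q"
        using bound[OF _ x fin(1), of t]
        by (cases "t \<in> {0..\<delta>}") (auto simp: P_def algebra_simps)
    qed (intro Bochner_Integration.integrable_sum int)
    also have "\<dots> = \<delta> * Q" using \<open>0 \<le> \<delta>\<close> by simp
    finally show "(\<Sum>l\<in>L. \<integral>t. indicator {0..\<delta>} t * (norm (P (of_int l + x) t))\<^sup>2 \<partial>lborel) \<le> \<delta> * Q" .
  qed
  also have "\<dots> = real (card X) * (\<delta> * Q)" by simp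
  finally have "ennreal (\<Sum>\<gamma>\<in>F. I \<gamma>) \<le> ennreal (real (card X) * (\<delta> * Q))"
    by (rule ennreal_leI)
  then show "(\<Sum>\<gamma>\<in>F. ennreal ((cmod (L2_inner f (tf_shift \<gamma> g)))\<^sup>2)) \<le> ennreal (real (card X) * (\<delta> * Q))"
    by (simp add: I_def sum_ennreal)
qed (rule nonneg_summable_on_complete, simp)

text \<open>Tested on the window function, the lower frame bound becomes an inequality with a factor
  \<delta> on both sides. Cancelling it leaves \<open>A * K\<close> bounded by
  \<open>card X * M * (W + K * \<eta>)\<close>, where \<eta> bounds the periodizations on
  [0, \<delta>] shifted by the points of \<open>X\<close>. Small \<eta> and large \<open>K\<close>
  contradict this.\<close>

theorem not_gabor_frame_if_periodization_zero:
  fixes g :: "real \<Rightarrow> complex" and X :: "real set"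
  assumes decay: "exp_decay g" and cont: "continuous_on UNIV g" and "finite X"
    and zero: "\<And>x. x \<in> X \<Longrightarrow> periodization g (- x) = 0"
  shows "\<not> gabor_frame g ((\<Union>x\<in>X. (\<lambda>m. m + x) ` \<int>) \<times> \<int>)"
proof
  assume "gabor_frame g ((\<Union>x\<in>X. (\<lambda>m. m + x) ` \<int>) \<times> \<int>)"
  then obtain A where "A > 0" and A: "\<And>f. f \<in> L2_real \<Longrightarrow> ennreal (A * (L2_norm f)\<^sup>2) \<le>
     (\<Sum>\<^sub>\<infinity>\<gamma>\<in>(\<Union>x\<in>X. (\<lambda>m. m + x) ` \<int>) \<times> \<int>. ennreal ((cmod (L2_inner f (tf_shift \<gamma> g)))\<^sup>2))"
    unfolding gabor_frame_def by blast
  obtain R where R: "\<And>x. x \<in> X \<Longrightarrow> \<bar>x\<bar> \<le> R"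
    using finite_imp_bounded[OF \<open>finite X\<close>] by (auto simp: bounded_iff)
  \<comment> \<open>The radius is \<open>R + 1\<close> because the arguments will be
    \<open>t - x\<close> with \<open>t\<close> in [0, 1] and \<bar>x\<bar> \<le> R.\<close>
  obtain M W where MW: "M \<ge> 0" "W \<ge> 0"
    and P: "\<And>u K L. \<bar>u\<bar> \<le> R + 1 \<Longrightarrow> finite L \<Longrightarrow>
       (\<Sum>l\<in>L. (norm (\<Sum>k\<in>{0..<int K}. g (u + of_int k - of_int l)))\<^sup>2)
         \<le> M * (W + real K * norm (periodization g u))"
    using truncated_periodization_square_sum[OF decay] by metis
  \<comment> \<open>The summand 1 makes \<open>c\<close> positive even if \<open>card X * M\<close>
    is 0. The next choice of \<eta> is such that \<open>c * (2 * (K * \<eta>))\<close> equals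
    \<open>A * K\<close>.\<close>
  define c where "c = real (card X) * M + 1"
  have c: "c > 0" "real (card X) * M < c" using MW by (auto simp: c_def intro: add_nonneg_pos)
  define \<eta> where "\<eta> = A / (2 * c)"
  have "\<eta> > 0" using \<open>A > 0\<close> c by (simp add: \<eta>_def)
  have "eventually (\<lambda>t. norm (periodization g (t - x)) < \<eta>) (nhds 0)" if "x \<in> X" for x
  proof -
    have "isCont (\<lambda>t. norm (periodization g (t - x))) 0"
      by (intro continuous_intros isCont_o2[OF _ isCont_periodization[OF decay cont]])
    then have "((\<lambda>t. norm (periodization g (t - x))) \<longlongrightarrow> 0) (nhds 0)"
      using zero[OF that] by (simp add: continuous_at tendsto_nhds_iff)
    then show ?thesis using \<open>\<eta> > 0\<close> by (rule order_tendstoD)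
  qed
  then have "eventually (\<lambda>t. \<forall>x\<in>X. norm (periodization g (t - x)) < \<eta>) (nhds 0)"
    using \<open>finite X\<close> by (simp add: eventually_ball_finite_distrib)
  then obtain d where "d > 0" and d: "\<And>t x. \<bar>t\<bar> < d \<Longrightarrow> x \<in> X \<Longrightarrow> norm (periodization g (t - x)) < \<eta>"
    unfolding eventually_nhds_metric by (auto simp: dist_real_def)
  \<comment> \<open>Halving \<open>d\<close> keeps the closed interval [0, \<delta>] inside the open
    set on which the periodizations are below \<eta>; the cap 1 keeps it inside the unit interval,
    as Bessel's inequality demands.\<close>
  define \<delta> where "\<delta> = min 1 (d / 2)"
  have \<delta>: "0 < \<delta>" "\<delta> \<le> 1" "\<delta> < d" using \<open>d > 0\<close> by (auto simp: \<delta>_def)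
  \<comment> \<open>The contribution \<open>W\<close> of the window ends was fixed before
    \<open>K\<close>, so a long window makes it smaller than \<open>K * \<eta>\<close>.\<close>
  obtain K :: nat where K: "real K > W / \<eta>" using reals_Archimedean2 by blast
  then have "W < real K * \<eta>" using \<open>\<eta> > 0\<close> by (simp add: field_simps)
  have "real K > 0" using K MW \<open>\<eta> > 0\<close> by (smt (verit) divide_nonneg_pos)
  define f where "f t = (\<Sum>k\<in>{0..<int K}. indicator {0..\<delta>} (t - of_int k) :: complex)" for t
  define Q where "Q = M * (W + real K * \<eta>)"
  have "ennreal (A * (L2_norm f)\<^sup>2) \<le> ennreal (real (card X) * (\<delta> * Q))"
  proof (rule order_trans[OF A])
    show "f \<in> L2_real" unfolding f_def using L2_window(1) \<delta>(1) by simp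
    show "(\<Sum>\<^sub>\<infinity>\<gamma>\<in>(\<Union>x\<in>X. (\<lambda>m. m + x) ` \<int>) \<times> \<int>. ennreal ((cmod (L2_inner f (tf_shift \<gamma> g)))\<^sup>2))
       \<le> ennreal (real (card X) * (\<delta> * Q))"
      unfolding f_def[abs_def]
    proof (rule gabor_window_sum_bound[OF cont \<open>finite X\<close>])
      fix t x :: real and L :: "int set" assume t: "t \<in> {0..\<delta>}" and x: "x \<in> X" and L: "finite L"
      have "(\<Sum>l\<in>L. (norm (\<Sum>k\<in>{0..<int K}. g (t - x + of_int k - of_int l)))\<^sup>2)
        \<le> M * (W + real K * norm (periodization g (t - x)))"
        using t \<delta> R[OF x] L by (intro P) auto
      also have "\<dots> \<le> Q"
        unfolding Q_def using t x \<delta> MW d[of t x] by (intro mult_left_mono add_left_mono) auto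
      finally show "(\<Sum>l\<in>L. (norm (\<Sum>k\<in>{0..<int K}. g (t - x + of_int k - of_int l)))\<^sup>2) \<le> Q" .
    qed (use \<delta> in auto)
  qed
  moreover have "0 \<le> Q" unfolding Q_def using MW \<open>\<eta> > 0\<close> by simp
  ultimately have "A * (L2_norm f)\<^sup>2 \<le> real (card X) * (\<delta> * Q)"
    using \<delta>(1) by (subst (asm) ennreal_le_iff) auto
  moreover have "A * (real K * \<delta>) \<le> A * (L2_norm f)\<^sup>2"
    unfolding f_def[abs_def] using L2_window(2)[of \<delta> K] \<delta>(1) \<open>A > 0\<close> by (intro mult_left_mono) auto
  ultimately have "A * real K * \<delta> \<le> real (card X) * Q * \<delta>"
    by (simp add: algebra_simps)
  then have "A * real K \<le> real (card X) * Q" using \<delta>(1) by simp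
  also have "\<dots> = (real (card X) * M) * (W + real K * \<eta>)" by (simp add: Q_def)
  also have "\<dots> \<le> c * (W + real K * \<eta>)"
    using c MW \<open>\<eta> > 0\<close> by (intro mult_right_mono) auto
  also have "\<dots> < c * (2 * (real K * \<eta>))"
    using c(1) \<open>W < _\<close> by (intro mult_strict_left_mono) linarith+
  also have "\<dots> = A * real K" using c(1) by (simp add: \<eta>_def field_simps)
  finally show False by simp
qed

subsection \<open>Poisson summation for the cubic Gaussian\<close>

text \<open>The M-test gives uniform convergence along the net of finite index sets, so integration
  commutes with the unconditional sum.\<close>

lemma has_sum_integral_m_test:
  fixes f :: "'a \<Rightarrow> real \<Rightarrow> real"
  assumes cont: "\<And>k. continuous_on {a..b} (f k)"
    and bound: "\<And>k t. t \<in> {a..b} \<Longrightarrow> \<bar>f k t\<bar> \<le> M k" and M: "M summable_on UNIV"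
  shows "((\<lambda>k. integral {a..b} (f k)) has_sum integral {a..b} (\<lambda>t. \<Sum>\<^sub>\<infinity>k. f k t)) UNIV"
proof -
  have "uniform_limit {a..b} (\<lambda>X t. \<Sum>k\<in>X. f k t) (\<lambda>t. \<Sum>\<^sub>\<infinity>k. f k t) (finite_subsets_at_top UNIV)"
    using Weierstrass_m_test_general[OF _ M, of "{a..b}" f] bound by simp
  then obtain I J where IJ: "\<And>X. ((\<lambda>t. \<Sum>k\<in>X. f k t) has_integral I X) {a..b}"
    "((\<lambda>t. \<Sum>\<^sub>\<infinity>k. f k t) has_integral J) {a..b}" "(I \<longlongrightarrow> J) (finite_subsets_at_top UNIV)"
    by (rule uniform_limit_integral) (auto intro: continuous_intros cont)
  have "I X = (\<Sum>k\<in>X. integral {a..b} (f k))" if "finite X" for X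
    using IJ(1)[of X] that
    by (subst integral_sum[symmetric]) (auto intro: integrable_continuous_interval cont integral_unique[symmetric])
  then have "((\<lambda>X. \<Sum>k\<in>X. integral {a..b} (f k)) \<longlongrightarrow> J) (finite_subsets_at_top UNIV)"
    by (intro Lim_transform_eventually[OF IJ(3)] eventually_finite_subsets_at_top_weakI) auto
  then show ?thesis using IJ(2) by (simp add: has_sum_def integral_unique)
qed

lemma integral_cos_int:
  "integral {0..1} (\<lambda>t. cos (2 * pi * of_int j * t)) = of_bool (j = 0)"
proof (cases "j = 0")
  case False
  have "((\<lambda>t. cos (2 * pi * of_int j * t)) has_integral
     sin (2 * pi * of_int j * 1) / (2 * pi * of_int j) - sin (2 * pi * of_int j * 0) / (2 * pi * of_int j)) {0..1}"
    using False by (intro fundamental_theorem_of_calculus)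
      (auto intro!: derivative_eq_intros simp flip: has_real_derivative_iff_has_vector_derivative)
  moreover have "sin (2 * pi * of_int j * 1) = 0"
    using sin_int_2pin[of j] by (simp add: mult.commute mult.left_commute)
  ultimately show ?thesis using False by (simp add: integral_unique)
qed simp

text \<open>The product formula reduces this to two cosine integrals. The difference on the right
  also covers n = m = 0, where its terms cancel.\<close>

lemma integral_sin_mult_sin:
  "integral {0..1} (\<lambda>t. sin (2 * pi * of_int n * t) * sin (2 * pi * of_int m * t))
    = (of_bool (n = m) - of_bool (n = - m)) / 2"
proof -
  have eq: "sin (2 * pi * of_int n * t) * sin (2 * pi * of_int m * t) =
     (1/2) * (cos (2 * pi * of_int (n - m) * t) - cos (2 * pi * of_int (n + m) * t))" for t
  proof -
    have "2 * pi * of_int (n - m) * t = 2 * pi * of_int n * t - 2 * pi * of_int m * t"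
      "2 * pi * of_int (n + m) * t = 2 * pi * of_int n * t + 2 * pi * of_int m * t"
      by (simp_all add: algebra_simps)
    then show ?thesis by (simp only: cos_diff cos_add) simp
  qed
  have "integral {0..1} (\<lambda>t. sin (2 * pi * of_int n * t) * sin (2 * pi * of_int m * t)) =
     (1/2) * (integral {0..1} (\<lambda>t. cos (2 * pi * of_int (n - m) * t)) - integral {0..1} (\<lambda>t. cos (2 * pi * of_int (n + m) * t)))"
    unfolding eq integral_mult_right
    by (subst Henstock_Kurzweil_Integration.integral_diff) (auto intro!: integrable_continuous_interval continuous_intros)
  also have "\<dots> = (of_bool (n = m) - of_bool (n = - m)) / 2"
    unfolding integral_cos_int by (auto simp: of_bool_def)
  finally show ?thesis .
qed

text \<open>Multiplied by \<open>sin (2 * pi * t)\<close>, an odd 1-periodic function becomes a continuous function of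
  \<open>cos (2 * pi * t)\<close>, so the polynomial Weierstrass theorem applies.\<close>

lemma sine_coefficients_zero_imp_zero:
  fixes H :: "real \<Rightarrow> real"
  assumes cont: "continuous_on {0..1} H" and refl: "\<And>t. H (1 - t) = - H t"
    and coeff: "\<And>m::int. integral {0..1} (\<lambda>t. H t * sin (2 * pi * of_int m * t)) = 0"
    and t: "t \<in> {0..1}"
  shows "H t * sin (2 * pi * t) = 0"
proof -
  define S where "S t = H t * sin (2 * pi * t)" for t
  have Sc: "continuous_on {0..1} S"
    unfolding S_def[abs_def] by (intro continuous_intros cont)
  \<comment> \<open>The arccosine only reaches \<open>t\<close> in [0, 1/2]. The other half follows
    from \<open>S (1 - t) = S t\<close>, since both factors of \<open>S\<close> change sign under
    the reflection.\<close>
  define F where "F y = S (arccos y / (2 * pi))" for y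
  have arc: "arccos y / (2 * pi) \<in> {0..1}" if "y \<in> {-1..1}" for y
    using arccos_bounded[of y] that pi_gt_zero by (auto simp: field_simps intro: order_trans[of _ pi])
  have Fc: "continuous_on {-1..1} F"
    unfolding F_def[abs_def] using arc
    by (intro continuous_on_compose2[OF Sc] continuous_intros continuous_on_arccos') auto
  have FS: "F (cos (2 * pi * t)) = S t" if t: "t \<in> {0..1}" for t
  proof (cases "t \<le> 1/2")
    case True
    then have "arccos (cos (2 * pi * t)) = 2 * pi * t" using t by (intro arccos_cos) auto
    then show ?thesis by (simp add: F_def)
  next
    case False
    have "cos (2 * pi * t) = cos (2 * pi * (1 - t))"
      by (simp add: algebra_simps cos_diff)
    moreover have "arccos (cos (2 * pi * (1 - t))) = 2 * pi * (1 - t)"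
      using t False by (intro arccos_cos) auto
    ultimately have "F (cos (2 * pi * t)) = S (1 - t)" by (simp add: F_def)
    also have "\<dots> = S t"
      using refl[of t] by (simp add: S_def algebra_simps sin_diff)
    finally show ?thesis .
  qed
  \<comment> \<open>Multiplication by \<open>cos (2 * pi * t)\<close> turns the frequency
    \<open>m\<close> into the mean of \<open>m + 1\<close> and \<open>m - 1\<close>; hence the
    induction is over all frequencies at once.\<close>
  have trig: "integral {0..1} (\<lambda>t. H t * sin (2 * pi * of_int m * t) * cos (2 * pi * t) ^ k) = 0" for k and m :: int
  proof (induction k arbitrary: m)
    case (Suc k)
    have eq: "H t * sin (2 * pi * of_int m * t) * cos (2 * pi * t) ^ Suc k =
      (1/2) * (H t * sin (2 * pi * of_int (m + 1) * t) * cos (2 * pi * t) ^ k + H t * sin (2 * pi * of_int (m - 1) * t) * cos (2 * pi * t) ^ k)" for t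
    proof -
      have "sin (2 * pi * of_int m * t) * cos (2 * pi * t) =
        (1/2) * (sin (2 * pi * of_int (m + 1) * t) + sin (2 * pi * of_int (m - 1) * t))"
      proof -
        have "2 * pi * of_int (m + 1) * t = 2 * pi * of_int m * t + 2 * pi * t"
          "2 * pi * of_int (m - 1) * t = 2 * pi * of_int m * t - 2 * pi * t"
          by (simp_all add: algebra_simps)
        then show ?thesis by (simp only: sin_diff sin_add) simp
      qed
      then have "H t * (sin (2 * pi * of_int m * t) * cos (2 * pi * t)) * cos (2 * pi * t) ^ k = 
         H t * ((1/2) * (sin (2 * pi * of_int (m + 1) * t) + sin (2 * pi * of_int (m - 1) * t))) * cos (2 * pi * t) ^ k"
        by simp
      then show ?thesis by (simp add: algebra_simps)
    qed
    have int: "(\<lambda>t. H t * sin (2 * pi * of_int j * t) * cos (2 * pi * t) ^ k) integrable_on {0..1}" for j :: int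
      by (intro integrable_continuous_interval continuous_intros cont)
    show ?case
      unfolding eq integral_mult_right Henstock_Kurzweil_Integration.integral_add[OF int int] Suc.IH by simp
  qed (use coeff in simp)
  define B where "B = integral {0..1} (\<lambda>t. \<bar>S t\<bar>)"
  have B0: "B \<ge> 0" unfolding B_def
    by (intro integral_nonneg integrable_continuous_interval continuous_intros Sc) auto
  \<comment> \<open>If \<open>q\<close> approximates \<open>F\<close> to within \<epsilon>, then
    \<open>S\<close> is orthogonal to \<open>q (cos (2 * pi * t))\<close>, so the integral of the
    square of \<open>S\<close> equals that of \<open>S\<close> times the approximation
    error.\<close>
  have le: "integral {0..1} (\<lambda>t. (S t)\<^sup>2) \<le> \<epsilon> * B" if "\<epsilon> > 0" for \<epsilon>
  proof -
    obtain q where q: "real_polynomial_function q" "\<And>y. y \<in> {-1..1} \<Longrightarrow> \<bar>F y - q y\<bar> < \<epsilon>"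
      using Stone_Weierstrass_real_polynomial_function[OF compact_Icc Fc \<open>\<epsilon> > 0\<close>] by metis
    then obtain a n where qa: "q = (\<lambda>y. \<Sum>i\<le>n. a i * y ^ i)"
      by (auto simp: real_polynomial_function_iff_sum)
    have qc: "continuous_on {0..1} (\<lambda>t. q (cos (2 * pi * t)))"
      unfolding qa by (intro continuous_intros)
    have "integral {0..1} (\<lambda>t. S t * q (cos (2 * pi * t))) =
       integral {0..1} (\<lambda>t. \<Sum>i\<le>n. a i * (H t * sin (2 * pi * of_int 1 * t) * cos (2 * pi * t) ^ i))"
      by (simp add: S_def qa sum_distrib_left algebra_simps)
    also have "\<dots> = (\<Sum>i\<le>n. integral {0..1} (\<lambda>t. a i * (H t * sin (2 * pi * of_int 1 * t) * cos (2 * pi * t) ^ i)))"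
      by (intro integral_sum integrable_continuous_interval continuous_intros cont) auto
    also have "\<dots> = 0" by (simp only: integral_mult_right trig) simp
    finally have z: "integral {0..1} (\<lambda>t. S t * q (cos (2 * pi * t))) = 0" .
    have "integral {0..1} (\<lambda>t. (S t)\<^sup>2) = integral {0..1} (\<lambda>t. (S t)\<^sup>2 - S t * q (cos (2 * pi * t)))"
      by (subst Henstock_Kurzweil_Integration.integral_diff)
        (auto intro!: integrable_continuous_interval continuous_intros Sc qc simp: z)
    also have "\<dots> \<le> integral {0..1} (\<lambda>t. \<epsilon> * \<bar>S t\<bar>)"
    proof (intro integral_le integrable_continuous_interval continuous_intros Sc qc)
      fix t :: real assume t: "t \<in> {0..1}"
      have "\<bar>S t - q (cos (2 * pi * t))\<bar> \<le> \<epsilon>"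
        using q(2)[of "cos (2 * pi * t)"] FS[OF t] by simp
      then have "\<bar>S t\<bar> * \<bar>S t - q (cos (2 * pi * t))\<bar> \<le> \<bar>S t\<bar> * \<epsilon>"
        by (intro mult_left_mono) auto
      then have "\<bar>S t * (S t - q (cos (2 * pi * t)))\<bar> \<le> \<epsilon> * \<bar>S t\<bar>"
        by (simp add: abs_mult mult.commute)
      then show "(S t)\<^sup>2 - S t * q (cos (2 * pi * t)) \<le> \<epsilon> * \<bar>S t\<bar>"
        by (simp add: power2_eq_square algebra_simps)
    qed
    also have "\<dots> = \<epsilon> * B" by (simp add: B_def)
    finally show ?thesis .
  qed
  have "integral {0..1} (\<lambda>t. (S t)\<^sup>2) \<le> 0"
  proof (rule field_le_epsilon)
    fix e :: real assume "e > 0"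
    \<comment> \<open>The accuracy is divided by \<open>B + 1\<close> since \<open>B\<close> may be
      0.\<close>
    have "integral {0..1} (\<lambda>t. (S t)\<^sup>2) \<le> e / (B + 1) * B"
      using \<open>e > 0\<close> B0 by (intro le) auto
    also have "\<dots> \<le> 0 + e" using \<open>e > 0\<close> B0 by (simp add: field_simps)
    finally show "integral {0..1} (\<lambda>t. (S t)\<^sup>2) \<le> 0 + e" .
  qed
  moreover have "integral {0..1} (\<lambda>t. (S t)\<^sup>2) \<ge> 0"
    by (intro integral_nonneg integrable_continuous_interval continuous_intros Sc) auto
  ultimately have "integral {0..1} (\<lambda>t. (S t)\<^sup>2) = 0" by linarith
  then have "\<forall>t\<in>{0..1}. (S t)\<^sup>2 = 0"
    by (subst (asm) integral_eq_0_iff) (auto intro!: continuous_intros Sc)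
  then show ?thesis using t by (simp add: S_def)
qed

text \<open>Up to a constant factor, this is \<open>hermite_fun 3 (sqrt 3 * t)\<close>.\<close>

definition cubic_gaussian :: "real \<Rightarrow> real" where
  "cubic_gaussian t = (4 * pi * t ^ 3 - t) * exp (- 3 * pi * t\<^sup>2)"

lemma cubic_gaussian_minus: "cubic_gaussian (- t) = - cubic_gaussian t"
  by (simp add: cubic_gaussian_def algebra_simps)

lemma continuous_on_cubic_gaussian: "continuous_on A cubic_gaussian"
  unfolding cubic_gaussian_def[abs_def] by (intro continuous_intros)

text \<open>The polynomial is at most a constant times exp \<bar>t\<bar>, and the Gaussian is at
  most exp (1 - 2\<bar>t\<bar>) because 2\<bar>t\<bar> \<le> 1 + t^2. The product retains one factor
  exp (- \<bar>t\<bar>).\<close>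

lemma exp_decay_cubic_gaussian: "exp_decay cubic_gaussian"
  unfolding exp_decay_def
proof (intro exI allI)
  fix t :: real
  have "\<bar>t\<bar> / 3 \<le> exp (\<bar>t\<bar> / 3)"
    using exp_ge_add_one_self[of "\<bar>t\<bar> / 3"] by linarith
  then have "(\<bar>t\<bar> / 3) ^ 3 \<le> exp (\<bar>t\<bar> / 3) ^ 3" by (intro power_mono) auto
  also have "\<dots> = exp \<bar>t\<bar>" using exp_of_nat_mult[of 3 "\<bar>t\<bar> / 3"] by simp
  finally have 3: "\<bar>t\<bar> ^ 3 \<le> 27 * exp \<bar>t\<bar>" by (simp add: power_divide)
  have 1: "\<bar>t\<bar> \<le> exp \<bar>t\<bar>" using exp_ge_add_one_self[of "\<bar>t\<bar>"] by linarith
  have "\<bar>4 * pi * t ^ 3 - t\<bar> \<le> 4 * pi * \<bar>t\<bar> ^ 3 + \<bar>t\<bar>"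
    using abs_triangle_ineq4[of "4 * pi * t ^ 3" t] by (simp add: abs_mult power_abs)
  also have "\<dots> \<le> 4 * pi * (27 * exp \<bar>t\<bar>) + exp \<bar>t\<bar>"
    by (intro add_mono mult_left_mono 1 3) auto
  also have "\<dots> = (108 * pi + 1) * exp \<bar>t\<bar>" by (simp add: algebra_simps)
  finally have p: "\<bar>4 * pi * t ^ 3 - t\<bar> \<le> (108 * pi + 1) * exp \<bar>t\<bar>" .
  have "0 \<le> (\<bar>t\<bar> - 1)\<^sup>2" by simp
  then have "2 * \<bar>t\<bar> \<le> 1 + t\<^sup>2" by (simp add: power2_eq_square algebra_simps)
  also have "\<dots> \<le> 1 + 3 * pi * t\<^sup>2"
    using pi_gt3 by (intro add_left_mono) (simp add: mult_le_cancel_right1)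
  finally have "exp (- 3 * pi * t\<^sup>2) \<le> exp (1 - 2 * \<bar>t\<bar>)" by simp
  with p have "norm (cubic_gaussian t) \<le> ((108 * pi + 1) * exp \<bar>t\<bar>) * exp (1 - 2 * \<bar>t\<bar>)"
    unfolding cubic_gaussian_def real_norm_def abs_mult by (intro mult_mono) auto
  also have "\<dots> = ((108 * pi + 1) * exp 1) * exp (- \<bar>t\<bar>)"
    by (simp add: exp_add[symmetric])
  finally show "norm (cubic_gaussian t) \<le> ((108 * pi + 1) * exp 1) * exp (- \<bar>t\<bar>)" .
qed

section \<open>The Fourier sine transform of the cubic Gaussian\<close>

lemma std_normal_cos_integral:
  "has_bochner_integral lborel (\<lambda>x. std_normal_density x * cos (r * x)) (exp (- (r\<^sup>2) / 2))"
proof -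
  have nd: "integrable lborel std_normal_density"
    by (rule integrable_normal_density) simp
  have int: "integrable lborel (\<lambda>x. std_normal_density x * cos (r * x))"
  proof (rule Bochner_Integration.integrable_bound[OF nd])
    show "AE x in lborel. norm (std_normal_density x * cos (r * x)) \<le> norm (std_normal_density x)"
      unfolding real_norm_def abs_mult by (intro AE_I2 mult_left_le) auto
  qed measurable
  \<comment> \<open>The cosine integral is the real part of the characteristic function of the
    standard normal distribution, whose value is known.\<close>
  have "char std_normal_distribution r = (\<integral>x. std_normal_density x *\<^sub>R iexp (r * x) \<partial>lborel)"
    unfolding char_def by (subst integral_density) auto
  moreover have "Re (\<integral>x. std_normal_density x *\<^sub>R iexp (r * x) \<partial>lborel) =
      (\<integral>x. Re (std_normal_density x *\<^sub>R iexp (r * x)) \<partial>lborel)"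
  proof (rule integral_Re[symmetric], rule Bochner_Integration.integrable_bound[OF nd])
    show "AE x in lborel. norm (std_normal_density x *\<^sub>R iexp (r * x)) \<le> norm (std_normal_density x)"
      by (intro AE_I2) simp
  qed measurable
  moreover have "Re (std_normal_density x *\<^sub>R iexp (r * x)) = std_normal_density x * cos (r * x)" for x
    by (simp add: Re_exp)
  ultimately have Re_char: "(\<integral>x. std_normal_density x * cos (r * x) \<partial>lborel) = Re (char std_normal_distribution r)"
    by (simp only:)
  show ?thesis
    using int unfolding has_bochner_integral_iff Re_char char_std_normal_distribution by simp
qed

text \<open>The substitution x = c t with c^2 = 6 pi carries the exponent - x^2 / 2 of the normal
  density to - 3 pi t^2; the frequency is divided by \<open>c\<close> to compensate.\<close>

lemma gaussian_cos_integral: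
  "has_bochner_integral lborel (\<lambda>t. exp (- 3 * pi * t\<^sup>2) * cos (2 * pi * s * t)) (exp (- pi * s\<^sup>2 / 3) / sqrt 3)"
proof -
  define c where "c = sqrt (6 * pi)"
  have "c = sqrt 3 * sqrt (2 * pi)"
    using real_sqrt_mult[of 3 "2 * pi"] unfolding c_def by simp
  then have "sqrt (2 * pi) = c / sqrt 3" by simp
  moreover have "c > 0" "c\<^sup>2 = 6 * pi" by (simp_all add: c_def)
  ultimately have c: "c > 0" "c\<^sup>2 = 6 * pi" "sqrt (2 * pi) = c / sqrt 3" by blast+
  have r: "(2 * pi * s / c)\<^sup>2 = 2 * (pi * s\<^sup>2 / 3)"
    using pi_gt_zero unfolding power_divide power_mult_distrib c(2) by (simp add: power2_eq_square)
  have e: "std_normal_density (0 + c * x) * cos (2 * pi * s / c * (0 + c * x)) =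
    (sqrt 3 / c) * (exp (- 3 * pi * x\<^sup>2) * cos (2 * pi * s * x))" for x
  proof -
    have "std_normal_density (c * x) = (sqrt 3 / c) * exp (- 3 * pi * x\<^sup>2)"
      using c(1) by (simp only: std_normal_density_def c power_mult_distrib) simp
    moreover have "2 * pi * s / c * (c * x) = 2 * pi * s * x" using c(1) by simp
    ultimately show ?thesis by (simp only: mult.assoc add_0)
  qed
  have "c \<noteq> 0" using c(1) by simp
  from iffD1[OF lborel_has_bochner_integral_real_affine_iff[OF this, of _ _ 0] std_normal_cos_integral[of "2 * pi * s / c"]]
  have "has_bochner_integral lborel (\<lambda>x. (sqrt 3 / c) * (exp (- 3 * pi * x\<^sup>2) * cos (2 * pi * s * x)))
     (exp (- ((2 * pi * s / c)\<^sup>2) / 2) /\<^sub>R \<bar>c\<bar>)"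
    unfolding e .
  moreover have "E /\<^sub>R \<bar>c\<bar> = E / c" for E :: real
    using c(1) by (auto simp: divide_inverse mult.commute)
  moreover have "- ((2 * pi * s / c)\<^sup>2) / 2 = - (pi * s\<^sup>2 / 3)"
    unfolding r by simp
  ultimately have "has_bochner_integral lborel (\<lambda>x. (sqrt 3 / c) * (exp (- 3 * pi * x\<^sup>2) * cos (2 * pi * s * x)))
     (exp (- (pi * s\<^sup>2 / 3)) / c)"
    by (simp only:)
  from has_bochner_integral_mult_right[OF this, of "c / sqrt 3"] c(1) show ?thesis
    by simp
qed

text \<open>\<open>\<psi>\<close> is the negative imaginary part of \<open>(\<alpha> * t\<^sup>2 + \<beta> * t + \<kappa>) * exp (- 3 * pi * t\<^sup>2 - 2 * pi * \<i> * s * t)\<close>,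
  with \<open>\<alpha>\<close>, \<open>\<beta>\<close>, \<open>\<kappa>\<close> chosen such that the derivative differs from the integrand of the Fourier
  transform only by a multiple of the Gaussian.\<close>

lemma cubic_gaussian_sin_antiderivative:
  fixes s :: real
  defines "\<psi> \<equiv> (\<lambda>t. exp (- 3 * pi * t\<^sup>2) *
     (((4 * pi * s\<^sup>2 / 9 - 1/3) / (6 * pi) - 2/3 * t\<^sup>2) * sin (2 * pi * s * t) - 2 * s / 9 * t * cos (2 * pi * s * t)))"
  shows "(\<psi> has_real_derivative cubic_gaussian t * sin (2 * pi * s * t)
     + (4 * pi * (s/3)^3 - s/3) * (exp (- 3 * pi * t\<^sup>2) * cos (2 * pi * s * t))) (at t)"
proof -
  define E C S \<kappa> where "E = exp (- 3 * pi * t\<^sup>2)" and "C = cos (2 * pi * s * t)" and "S = sin (2 * pi * s * t)"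
    and "\<kappa> = (4 * pi * s\<^sup>2 / 9 - 1/3) / (6 * pi)"
  have k: "pi * \<kappa> = (4 * pi * s\<^sup>2 / 9 - 1/3) / 6" by (simp add: \<kappa>_def)
  have "(\<psi> has_real_derivative
      E * ((- (4/3) * t) * S + (\<kappa> - 2/3 * t\<^sup>2) * (C * (2 * pi * s)) - (2 * s / 9 * C - 2 * s / 9 * t * (S * (2 * pi * s))))
      + E * (- 6 * pi * t) * ((\<kappa> - 2/3 * t\<^sup>2) * S - 2 * s / 9 * t * C)) (at t)"
    unfolding \<psi>_def E_def C_def S_def \<kappa>_def[symmetric]
    by (rule derivative_eq_intros refl | simp)+
  \<comment> \<open>The identity is polynomial with \<kappa> left opaque. All terms involving
    \<kappa> are gathered in the last summand, whose first factor vanishes by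
    \<open>k\<close>.\<close>
  moreover have "E * ((- (4/3) * t) * S + (\<kappa> - 2/3 * t\<^sup>2) * (C * (2 * pi * s)) - (2 * s / 9 * C - 2 * s / 9 * t * (S * (2 * pi * s))))
      + E * (- 6 * pi * t) * ((\<kappa> - 2/3 * t\<^sup>2) * S - 2 * s / 9 * t * C) = 
      (4 * pi * t ^ 3 - t) * E * S + (4 * pi * (s/3)^3 - s/3) * (E * C)
      + (pi * \<kappa> - (4 * pi * s\<^sup>2 / 9 - 1/3) / 6) * (E * (2 * s * C - 6 * t * S))"
    by (simp add: algebra_simps power2_eq_square power3_eq_cube diff_divide_distrib)
  ultimately show ?thesis by (simp add: k cubic_gaussian_def E_def C_def S_def)
qed

text \<open>Dominated convergence with majorant \<bar>f\<bar> links the Lebesgue integral over the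
  line to the integrals over [-K, K], on which the fundamental theorem of calculus is used.\<close>

lemma tendsto_integral_symmetric_interval:
  fixes f :: "real \<Rightarrow> real"
  assumes "has_bochner_integral lborel f I"
  shows "(\<lambda>K::nat. integral {-real K..real K} f) \<longlonglongrightarrow> I"
proof -
  have int: "integrable lborel f" and I: "I = (\<integral>t. f t \<partial>lborel)"
    using assms by (auto simp: has_bochner_integral_iff)
  have [measurable]: "f \<in> borel_measurable borel" using borel_measurable_integrable[OF int] by simp
  have "(\<lambda>K::nat. \<integral>t. indicator {-real K..real K} t *\<^sub>R f t \<partial>lborel) \<longlonglongrightarrow> (\<integral>t. f t \<partial>lborel)"
  proof (rule integral_dominated_convergence[where w = "\<lambda>t. norm (f t)"])
    show "AE t in lborel. (\<lambda>K::nat. indicator {-real K..real K} t *\<^sub>R f t) \<longlonglongrightarrow> f t"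
    proof (rule AE_I2)
      fix t :: real
      obtain N :: nat where N: "\<bar>t\<bar> \<le> real N" using real_arch_simple by blast
      have "eventually (\<lambda>K::nat. indicator {-real K..real K} t *\<^sub>R f t = f t) sequentially"
        using eventually_ge_at_top[of N] by eventually_elim (use N in \<open>auto simp: indicator_def\<close>)
      then show "(\<lambda>K::nat. indicator {-real K..real K} t *\<^sub>R f t) \<longlonglongrightarrow> f t"
        by (rule tendsto_eventually)
    qed
  qed (use int in \<open>auto simp: indicator_def\<close>)
  moreover have "(\<integral>t. indicator {-real K..real K} t *\<^sub>R f t \<partial>lborel) = integral {-real K..real K} f" for K :: nat
  proof -
    have "set_integrable lborel {-real K..real K} f"
      unfolding set_integrable_def by (rule integrable_mult_indicator[OF _ int]) auto
    from set_borel_integral_eq_integral(2)[OF this] show ?thesis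
      by (simp add: set_lebesgue_integral_def)
  qed
  ultimately show ?thesis by (simp add: I)
qed

text \<open>Up to scaling, the cubic Gaussian is an eigenfunction of the sine transform. Integrating
  the derivative of \<psi> over [-K, K] leaves a boundary term, which tends to 0, and a multiple of
  the known cosine integral of the Gaussian. The minus sign here is what later forces the
  periodization to vanish at 1/3.\<close>

lemma cubic_gaussian_sine_transform:
  "(\<lambda>K::nat. integral {-real K..real K} (\<lambda>t. cubic_gaussian t * sin (2 * pi * s * t)))
     \<longlonglongrightarrow> - cubic_gaussian (s / 3) / sqrt 3"
proof -
  define \<kappa> where "\<kappa> = (4 * pi * s\<^sup>2 / 9 - 1/3) / (6 * pi)"
  define \<psi> where "\<psi> t = exp (- 3 * pi * t\<^sup>2) * ((\<kappa> - 2/3 * t\<^sup>2) * sin (2 * pi * s * t) - 2 * s / 9 * t * cos (2 * pi * s * t))" for t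
  define c where "c = 4 * pi * (s/3)^3 - s/3"
  define E where "E t = exp (- 3 * pi * t\<^sup>2) * cos (2 * pi * s * t)" for t
  have Ec: "continuous_on A E" for A unfolding E_def[abs_def] by (intro continuous_intros)
  have d: "(\<psi> has_real_derivative cubic_gaussian t * sin (2 * pi * s * t) + c * E t) (at t)" for t
    using cubic_gaussian_sin_antiderivative[of s t] by (simp add: \<psi>_def[abs_def] \<kappa>_def c_def E_def)
  have eq: "integral {-real K..real K} (\<lambda>t. cubic_gaussian t * sin (2 * pi * s * t)) = 2 * \<psi> (real K) - c * integral {-real K..real K} E" for K :: nat
  proof -
    have "((\<lambda>t. cubic_gaussian t * sin (2 * pi * s * t) + c * E t) has_integral \<psi> (real K) - \<psi> (-real K)) {-real K..real K}"
      by (intro fundamental_theorem_of_calculus)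
        (auto intro: has_field_derivative_at_within d simp flip: has_real_derivative_iff_has_vector_derivative)
    moreover have "\<psi> (- real K) = - \<psi> (real K)" by (simp add: \<psi>_def algebra_simps)
    ultimately have "integral {-real K..real K} (\<lambda>t. cubic_gaussian t * sin (2 * pi * s * t) + c * E t) = 2 * \<psi> (real K)"
      by (simp add: integral_unique)
    also have "integral {-real K..real K} (\<lambda>t. cubic_gaussian t * sin (2 * pi * s * t) + c * E t) =
      integral {-real K..real K} (\<lambda>t. cubic_gaussian t * sin (2 * pi * s * t)) + integral {-real K..real K} (\<lambda>t. c * E t)"
      by (intro Henstock_Kurzweil_Integration.integral_add integrable_continuous_interval continuous_intros continuous_on_cubic_gaussian Ec)
    finally show ?thesis by simp
  qed
  have "(\<lambda>K::nat. integral {-real K..real K} E) \<longlonglongrightarrow> exp (- pi * s\<^sup>2 / 3) / sqrt 3"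
    unfolding E_def[abs_def] by (rule tendsto_integral_symmetric_interval[OF gaussian_cos_integral])
  moreover have "(\<lambda>K. \<psi> (real K)) \<longlonglongrightarrow> 0"
  proof (rule Lim_null_comparison)
    define a b where "a = \<bar>\<kappa>\<bar>" and "b = \<bar>2 * s / 9\<bar>"
    show "(\<lambda>K::nat. exp (- 3 * pi * (real K)\<^sup>2) * (a + 2/3 * (real K)\<^sup>2 + b * real K)) \<longlonglongrightarrow> 0"
      by real_asymp
    have "norm (\<psi> (real K)) \<le> exp (- 3 * pi * (real K)\<^sup>2) * (a + 2/3 * (real K)\<^sup>2 + b * real K)" for K :: nat
    proof -
      have 1: "\<bar>(\<kappa> - 2/3 * (real K)\<^sup>2) * sin (2 * pi * s * real K)\<bar> \<le> (a + 2/3 * (real K)\<^sup>2) * 1"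
        unfolding abs_mult a_def
          by (intro mult_mono order_trans[OF abs_triangle_ineq4]) auto
      have 2: "\<bar>2 * s / 9 * real K * cos (2 * pi * s * real K)\<bar> \<le> (b * real K) * 1"
        unfolding abs_mult[of _ "cos _"] by (intro mult_mono) (auto simp: b_def abs_mult)
      have "\<bar>(\<kappa> - 2/3 * (real K)\<^sup>2) * sin (2 * pi * s * real K) - 2 * s / 9 * real K * cos (2 * pi * s * real K)\<bar>
        \<le> a + 2/3 * (real K)\<^sup>2 + b * real K"
        using abs_triangle_ineq4 1 2 by (rule order_trans[OF _ order_trans[OF add_mono]]) simp
      then show ?thesis unfolding \<psi>_def real_norm_def abs_mult[of "exp _"] abs_exp_cancel
        by (rule mult_left_mono) (rule exp_ge_zero)
    qed
    then show "eventually (\<lambda>K::nat. norm (\<psi> (real K)) \<le> exp (- 3 * pi * (real K)\<^sup>2) * (a + 2/3 * (real K)\<^sup>2 + b * real K)) sequentially"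
      by simp
  qed
  ultimately have "(\<lambda>K::nat. 2 * \<psi> (real K) - c * integral {-real K..real K} E) \<longlonglongrightarrow> 2 * 0 - c * (exp (- pi * s\<^sup>2 / 3) / sqrt 3)"
    by (intro tendsto_intros)
  \<comment> \<open>Since 3 pi (s/3)^2 = pi s^2 / 3, the polynomial \<open>c\<close> and the
    Gaussian recombine to the cubic Gaussian at \<open>s / 3\<close>.\<close>
  moreover have "2 * 0 - c * (exp (- pi * s\<^sup>2 / 3) / sqrt 3) = - cubic_gaussian (s / 3) / sqrt 3"
    by (simp add: c_def cubic_gaussian_def power_divide)
  ultimately show ?thesis unfolding eq by simp
qed

text \<open>This extracts an ordinary limit from an unconditional sum. The intervals are half-open
  so that the unit intervals [k, k + 1] with \<open>k\<close> in them exactly tile [-K, K].\<close>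

lemma filterlim_symmetric_int_intervals:
  "filterlim (\<lambda>K. {-int K..<int K}) (finite_subsets_at_top UNIV) sequentially"
  unfolding filterlim_finite_subsets_at_top
proof (intro allI impI)
  fix X :: "int set" assume X: "finite X \<and> X \<subseteq> UNIV"
  define B where "B = (\<Sum>x\<in>X. \<bar>x\<bar>)"
  have B: "\<bar>x\<bar> \<le> B" if "x \<in> X" for x
    unfolding B_def using X that by (intro member_le_sum) auto
  show "eventually (\<lambda>K. finite {-int K..<int K} \<and> X \<subseteq> {-int K..<int K} \<and> {-int K..<int K} \<subseteq> UNIV) sequentially"
    using eventually_ge_at_top[of "nat (B + 1)"]
  proof eventually_elim
    case (elim K)
    have "x \<in> {-int K..<int K}" if "x \<in> X" for x using B[OF that] elim by auto
    then show ?case by auto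
  qed
qed

lemma sum_integral_translates:
  fixes f :: "real \<Rightarrow> real"
  assumes "continuous_on UNIV f"
  shows "(\<Sum>k\<in>{-int K..<int K}. integral {0..1} (\<lambda>t. f (t + of_int k))) = integral {-real K..real K} f"
proof (induction K)
  case (Suc K)
  have i: "f integrable_on {a..b}" for a b
    by (intro integrable_continuous_interval continuous_on_subset[OF assms]) auto
  have sh: "integral {0..1} (\<lambda>t. f (t + c)) = integral {c..1 + c} f" for c
    using integral_shift_Icc_real[of 0 1 f c] by (simp add: o_def add.commute)
  have "{-int (Suc K)..<int (Suc K)} = insert (- int K - 1) (insert (int K) {-int K..<int K})"
    by auto
  then have "(\<Sum>k\<in>{-int (Suc K)..<int (Suc K)}. integral {0..1} (\<lambda>t. f (t + of_int k))) =
     integral {-real K-1..-real K} f + (integral {real K..real K + 1} f + integral {-real K..real K} f)"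
    using Suc.IH by (simp add: sh add.commute)
  also have "\<dots> = integral {-real K-1..-real K} f + integral {-real K..real K + 1} f"
    using Henstock_Kurzweil_Integration.integral_combine[of "-real K" "real K" "real K + 1" f, OF _ _ i] by simp
  also have "\<dots> = integral {-real K-1..real K + 1} f"
    using Henstock_Kurzweil_Integration.integral_combine[of "-real K-1" "-real K" "real K + 1" f, OF _ _ i] by simp
  finally have "(\<Sum>k\<in>{-int (Suc K)..<int (Suc K)}. integral {0..1} (\<lambda>t. f (t + of_int k))) =
      integral {-real K-1..real K + 1} f" .
  moreover have "-real K-1 = - real (Suc K)" "real K + 1 = real (Suc K)" by simp_all
  ultimately show ?case by (simp only:)
qed simp

text \<open>Unfolding: the sine has period 1, so the integrals of all translates over [0, 1] join to
  the integral over the line, which is the sine transform at the integer \<open>m\<close>.\<close>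

lemma periodization_cubic_gaussian_coefficient:
  "integral {0..1} (\<lambda>t. periodization cubic_gaussian t * sin (2 * pi * of_int m * t))
    = - cubic_gaussian (of_int m / 3) / sqrt 3"
proof -
  let ?f = "\<lambda>k t. cubic_gaussian (t + of_int k) * sin (2 * pi * of_int m * t)"
  obtain C where "C \<ge> 0" and C: "\<And>u k. \<bar>u\<bar> \<le> 1 \<Longrightarrow> norm (cubic_gaussian (u + of_int k)) \<le> C * exp (- \<bar>real_of_int k\<bar>)"
    using exp_decay_shift[OF exp_decay_cubic_gaussian] by metis
  have "((\<lambda>k. integral {0..1} (?f k)) has_sum integral {0..1} (\<lambda>t. \<Sum>\<^sub>\<infinity>k. ?f k t)) UNIV"
  proof (rule has_sum_integral_m_test)
    show "(\<lambda>k::int. C * exp (- \<bar>real_of_int k\<bar>)) summable_on UNIV"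
      using summable_on_exp_minus_abs_int[of 1] by (intro summable_on_cmult_right) auto
    fix k and t :: real assume "t \<in> {0..1}"
    then have "\<bar>?f k t\<bar> \<le> (C * exp (- \<bar>real_of_int k\<bar>)) * 1"
      using C[of t k] unfolding abs_mult by (intro mult_mono) auto
    then show "\<bar>?f k t\<bar> \<le> C * exp (- \<bar>real_of_int k\<bar>)" by simp
  qed (intro continuous_intros continuous_on_compose2[OF continuous_on_cubic_gaussian[of UNIV]], auto)
  also have "(\<lambda>t. \<Sum>\<^sub>\<infinity>k. ?f k t) = (\<lambda>t. periodization cubic_gaussian t * sin (2 * pi * of_int m * t))"
    by (simp add: periodization_def infsum_cmult_left')
  finally have "(\<lambda>K. \<Sum>k\<in>{-int K..<int K}. integral {0..1} (?f k)) \<longlonglongrightarrow>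
      integral {0..1} (\<lambda>t. periodization cubic_gaussian t * sin (2 * pi * of_int m * t))"
    unfolding has_sum_def by (rule filterlim_compose[OF _ filterlim_symmetric_int_intervals])
  moreover have "(\<Sum>k\<in>{-int K..<int K}. integral {0..1} (?f k)) =
     integral {-real K..real K} (\<lambda>t. cubic_gaussian t * sin (2 * pi * of_int m * t))" for K
  proof -
    have "sin (2 * pi * of_int m * (t + of_int k)) = sin (2 * pi * of_int m * t)" for t and k :: int
    proof -
      have "2 * pi * of_int m * (t + of_int k) = 2 * pi * of_int m * t + 2 * pi * of_int (m * k)"
        by (simp add: algebra_simps)
      then show ?thesis using sin_int_2pin[of "m * k"] cos_int_2pin[of "m * k"] by (simp add: sin_add)
    qed
    then show ?thesis
      by (subst sum_integral_translates[symmetric])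
        (auto intro!: continuous_intros continuous_on_cubic_gaussian)
  qed
  ultimately show ?thesis
    using cubic_gaussian_sine_transform[of "of_int m"] LIMSEQ_unique by simp
qed

text \<open>This is the dual side of Poisson summation: up to the factor - 1 / sqrt 3 it is the
  Fourier series of the periodization. The sum runs over all integers, so each frequency occurs
  twice, with equal terms for \<open>n\<close> and \<open>-n\<close>.\<close>

definition cubic_gaussian_sine_series :: "real \<Rightarrow> real" where
  "cubic_gaussian_sine_series t = (\<Sum>\<^sub>\<infinity>n::int. cubic_gaussian (of_int n / 3) * sin (2 * pi * of_int n * t))"

lemma summable_on_cubic_gaussian_thirds:
  "(\<lambda>n::int. \<bar>cubic_gaussian (of_int n / 3)\<bar>) summable_on UNIV"
proof -
  obtain C where C: "\<And>t. norm (cubic_gaussian t) \<le> C * exp (- \<bar>t\<bar>)"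
    using exp_decay_cubic_gaussian by (auto simp: exp_decay_def)
  have "(\<lambda>n::int. C * exp (- (1/3) * \<bar>real_of_int n\<bar>)) summable_on UNIV"
    by (intro summable_on_cmult_right summable_on_exp_minus_abs_int) auto
  then show ?thesis
    by (rule summable_on_comparison_test) (use C[of "of_int _ / 3"] in auto)
qed

lemma abs_cubic_gaussian_sine_term:
  "\<bar>cubic_gaussian u * sin v\<bar> \<le> \<bar>cubic_gaussian u\<bar>"
  unfolding abs_mult by (intro mult_left_le) auto

lemma continuous_on_cubic_gaussian_sine_series:
  "continuous_on A cubic_gaussian_sine_series"
proof -
  have "uniform_limit A (\<lambda>X t. \<Sum>n\<in>X. cubic_gaussian (of_int n / 3) * sin (2 * pi * of_int n * t))
    cubic_gaussian_sine_series (finite_subsets_at_top UNIV)"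
    unfolding cubic_gaussian_sine_series_def[abs_def]
    by (rule Weierstrass_m_test_general[OF _ summable_on_cubic_gaussian_thirds])
      (simp add: abs_cubic_gaussian_sine_term del: abs_mult)
  then show ?thesis
    by (rule uniform_limit_theorem[rotated]) (auto intro!: always_eventually continuous_intros)
qed

text \<open>Only n = m and n = - m survive termwise integration. Each contributes half of the value,
  and oddness of the cubic Gaussian makes the halves add up.\<close>

lemma cubic_gaussian_sine_series_coefficient:
  "integral {0..1} (\<lambda>t. cubic_gaussian_sine_series t * sin (2 * pi * of_int m * t)) = cubic_gaussian (of_int m / 3)"
proof -
  let ?f = "\<lambda>n t. cubic_gaussian (of_int n / 3) * sin (2 * pi * of_int n * t) * sin (2 * pi * of_int m * t)"
  have "((\<lambda>n. integral {0..1} (?f n)) has_sum integral {0..1} (\<lambda>t. \<Sum>\<^sub>\<infinity>n. ?f n t)) UNIV"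
  proof (rule has_sum_integral_m_test[OF _ _ summable_on_cubic_gaussian_thirds])
    fix n and t :: real
    have "\<bar>?f n t\<bar> \<le> \<bar>cubic_gaussian (of_int n / 3)\<bar> * 1"
      unfolding abs_mult[of _ "sin (2 * pi * of_int m * t)"]
      by (intro mult_mono abs_cubic_gaussian_sine_term) auto
    then show "\<bar>?f n t\<bar> \<le> \<bar>cubic_gaussian (of_int n / 3)\<bar>" by simp
  qed (intro continuous_intros)
  also have "(\<lambda>t. \<Sum>\<^sub>\<infinity>n. ?f n t) = (\<lambda>t. cubic_gaussian_sine_series t * sin (2 * pi * of_int m * t))"
    by (simp add: cubic_gaussian_sine_series_def infsum_cmult_left')
  finally have 1: "((\<lambda>n. integral {0..1} (?f n)) has_sum
      integral {0..1} (\<lambda>t. cubic_gaussian_sine_series t * sin (2 * pi * of_int m * t))) UNIV" .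
  have eq: "integral {0..1} (?f n) = cubic_gaussian (of_int n / 3) / 2 * of_bool (n = m) - cubic_gaussian (of_int n / 3) / 2 * of_bool (n = - m)" for n
    by (simp only: mult.assoc[of "cubic_gaussian _"] integral_mult_right integral_sin_mult_sin)
      (simp add: right_diff_distrib diff_divide_distrib)
  have hs: "((\<lambda>n. cubic_gaussian (of_int n / 3) / 2 * of_bool (n = j)) has_sum cubic_gaussian (of_int j / 3) / 2) UNIV" for j :: int
    by (rule has_sum_finite_neutralI[of "{j}"]) auto
  have "((\<lambda>n. integral {0..1} (?f n)) has_sum (cubic_gaussian (of_int m / 3) / 2 - cubic_gaussian (of_int (- m) / 3) / 2)) UNIV"
    unfolding eq diff_conv_add_uminus by (intro has_sum_add has_sum_uminusI hs)
  from has_sum_unique[OF 1 this] show ?thesis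
    using cubic_gaussian_minus[of "of_int m / 3"] by simp
qed

lemma cubic_gaussian_sine_series_refl:
  "cubic_gaussian_sine_series (1 - t) = - cubic_gaussian_sine_series t"
proof -
  have "sin (2 * pi * of_int n * (1 - t)) = - sin (2 * pi * of_int n * t)" for n :: int
    using sin_int_2pin[of n] cos_int_2pin[of n] by (simp add: right_diff_distrib sin_diff)
  then show ?thesis by (simp add: cubic_gaussian_sine_series_def infsum_uminus)
qed

text \<open>On the residue class of \<open>j\<close> modulo 3 the sine is constant and the points
  n/3 run through \<open>j / 3 + k\<close>, so the class sums to a multiple of the periodization at
  \<open>j / 3\<close>. Class 0 drops out, and the classes of 1 and -1 agree by oddness, which gives
  the factor 2 sin (2 pi / 3) = sqrt 3.\<close>

lemma cubic_gaussian_sine_series_third: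
  "cubic_gaussian_sine_series (1/3) = sqrt 3 * periodization cubic_gaussian (1/3)"
proof -
  let ?f = "\<lambda>n::int. cubic_gaussian (of_int n / 3) * sin (2 * pi * of_int n * (1/3))"
  let ?P = "periodization cubic_gaussian"
  have hs: "((\<lambda>k. cubic_gaussian (u + of_int k)) has_sum ?P u) UNIV" for u
    unfolding periodization_def by (intro has_sum_infsum summable_on_int_translates exp_decay_cubic_gaussian)
  have sn: "sin (2 * pi * of_int (3 * k + j) * (1/3)) = sin (2 * pi * of_int j / 3)" for k j :: int
  proof -
    have e: "2 * pi * of_int (3 * k + j) * (1/3) = 2 * pi * of_int j / 3 + 2 * pi * of_int k"
      by (simp add: field_simps)
    show ?thesis using sin_int_2pin[of k] cos_int_2pin[of k] unfolding e sin_add by simp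
  qed
  have part: "(?f has_sum (?P (of_int j / 3) * sin (2 * pi * of_int j / 3))) (range (\<lambda>k. 3 * k + j))" for j
  proof -
    have "?f (3 * k + j) = cubic_gaussian (of_int j / 3 + of_int k) * sin (2 * pi * of_int j / 3)" for k
      unfolding sn by (simp add: add_divide_distrib add.commute)
    then have "((?f \<circ> (\<lambda>k. 3 * k + j)) has_sum (?P (of_int j / 3) * sin (2 * pi * of_int j / 3))) UNIV"
      using has_sum_cmult_left[OF hs, of "of_int j / 3" "sin (2 * pi * of_int j / 3)"] by (simp add: o_def)
    then show ?thesis by (subst has_sum_reindex) (auto simp: inj_on_def)
  qed
  have "(?f has_sum (?P (of_int 0 / 3) * sin (2 * pi * of_int 0 / 3) + ?P (of_int 1 / 3) * sin (2 * pi * of_int 1 / 3)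
     + ?P (of_int (-1) / 3) * sin (2 * pi * of_int (-1) / 3)))
     (range (\<lambda>k. 3 * k + 0) \<union> range (\<lambda>k. 3 * k + 1) \<union> range (\<lambda>k. 3 * k + (-1)))"
    by (intro has_sum_Un_disjoint part) (auto, presburger+)
  also have "range (\<lambda>k. 3 * k + 0) \<union> range (\<lambda>k. 3 * k + 1) \<union> range (\<lambda>k. 3 * k + (-1)) = (UNIV :: int set)"
    by (auto simp: image_iff) presburger
  finally have "cubic_gaussian_sine_series (1/3) = ?P (1/3) * sin (2 * pi / 3) - ?P (- (1/3)) * sin (2 * pi / 3)"
    unfolding cubic_gaussian_sine_series_def by (simp add: infsumI)
  also have "\<dots> = 2 * sin (2 * pi / 3) * ?P (1/3)"
    using periodization_minus_of_odd[of cubic_gaussian "1/3"] cubic_gaussian_minus by simp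
  also have "sin (2 * pi / 3) = sqrt 3 / 2"
    by (simp add: sin_120)
  finally show ?thesis by simp
qed

text \<open>The sum \<open>H\<close> of the periodization and its dual series divided by sqrt 3 has
  vanishing sine coefficients, hence is 0 wherever \<open>sin (2 * pi * t)\<close> is not. At 1/3
  both summands of \<open>H\<close> are equal, so each of them is 0.\<close>

lemma periodization_cubic_gaussian_third:
  "periodization cubic_gaussian (1/3) = 0"
proof -
  let ?P = "periodization cubic_gaussian" and ?T = "cubic_gaussian_sine_series"
  define H where "H t = ?P t + ?T t / sqrt 3" for t
  have Pc: "continuous_on A ?P" for A
    by (intro continuous_at_imp_continuous_on ballI isCont_periodization exp_decay_cubic_gaussian continuous_on_cubic_gaussian)
  have Prefl: "?P (1 - t) = - ?P t" for t
    using periodization_add_int[of cubic_gaussian "- t" 1] periodization_minus_of_odd[of cubic_gaussian t] cubic_gaussian_minus by simp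
  have "H (1/3) * sin (2 * pi * (1/3)) = 0"
  proof (rule sine_coefficients_zero_imp_zero)
    show "continuous_on {0..1} H"
      unfolding H_def[abs_def] by (intro continuous_intros Pc continuous_on_cubic_gaussian_sine_series) auto
    show "H (1 - t) = - H t" for t
      by (simp add: H_def Prefl cubic_gaussian_sine_series_refl)
    fix m :: int
    have "integral {0..1} (\<lambda>t. H t * sin (2 * pi * of_int m * t)) =
      integral {0..1} (\<lambda>t. ?P t * sin (2 * pi * of_int m * t) + (1 / sqrt 3) * (?T t * sin (2 * pi * of_int m * t)))"
      by (simp add: H_def algebra_simps)
    also have "\<dots> = integral {0..1} (\<lambda>t. ?P t * sin (2 * pi * of_int m * t)) + integral {0..1} (\<lambda>t. (1 / sqrt 3) * (?T t * sin (2 * pi * of_int m * t)))"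
      by (intro Henstock_Kurzweil_Integration.integral_add integrable_continuous_interval continuous_intros Pc continuous_on_cubic_gaussian_sine_series)
    also have "\<dots> = 0"
      unfolding integral_mult_right cubic_gaussian_sine_series_coefficient periodization_cubic_gaussian_coefficient by simp
    finally show "integral {0..1} (\<lambda>t. H t * sin (2 * pi * of_int m * t)) = 0" .
  qed auto
  moreover have "sin (2 * pi * (1/3)) \<noteq> 0"
    using sin_gt_zero[of "2 * pi * (1/3)"] by simp
  ultimately show ?thesis
    by (simp add: H_def cubic_gaussian_sine_series_third)
qed

subsection \<open>The third Hermite function\<close>

lemma periodization_of_real:
  assumes "exp_decay p"
  shows "periodization (\<lambda>t. of_real (c * p t)) u = (of_real (c * periodization p u) :: complex)"
proof -
  have "((\<lambda>k. p (u + of_int k)) has_sum periodization p u) UNIV"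
    unfolding periodization_def by (intro has_sum_infsum summable_on_int_translates assms)
  from has_sum_of_real[OF has_sum_cmult_right[OF this, of c]] show ?thesis
    unfolding periodization_def by (rule infsumI)
qed

lemma exp_decay_of_real:
  assumes "exp_decay p"
  shows "exp_decay (\<lambda>t. of_real (c * p t) :: complex)"
proof -
  obtain C where C: "\<And>t. norm (p t) \<le> C * exp (- \<bar>t\<bar>)"
    using assms by (auto simp: exp_decay_def)
  have "norm (of_real (c * p t) :: complex) \<le> (\<bar>c\<bar> * C) * exp (- \<bar>t\<bar>)" for t
    unfolding norm_of_real abs_mult mult.assoc using C[of t] by (intro mult_left_mono) auto
  then show ?thesis unfolding exp_decay_def by blast
qed

lemma hermite_fun_3:
  "hermite_fun 3 t = of_real (hermite_const 3 * 16 * pi\<^sup>2 * ((4 * pi * t ^ 3 - 3 * t) * exp (- pi * t\<^sup>2)))"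
proof -
  have 1: "deriv (\<lambda>s::real. exp (- 2 * pi * s\<^sup>2)) = (\<lambda>s. (- 4 * pi * s) * exp (- 2 * pi * s\<^sup>2))"
    by (intro ext DERIV_imp_deriv) (auto intro!: derivative_eq_intros)
  have 2: "deriv (\<lambda>s::real. (- 4 * pi * s) * exp (- 2 * pi * s\<^sup>2))
     = (\<lambda>s. (16 * pi\<^sup>2 * s\<^sup>2 - 4 * pi) * exp (- 2 * pi * s\<^sup>2))"
    by (intro ext DERIV_imp_deriv)
      (auto intro!: derivative_eq_intros simp: algebra_simps power2_eq_square)
  have 3: "deriv (\<lambda>s::real. (16 * pi\<^sup>2 * s\<^sup>2 - 4 * pi) * exp (- 2 * pi * s\<^sup>2))
     = (\<lambda>s. (48 * pi\<^sup>2 * s - 64 * pi ^ 3 * s ^ 3) * exp (- 2 * pi * s\<^sup>2))"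
    by (intro ext DERIV_imp_deriv)
      (auto intro!: derivative_eq_intros simp: algebra_simps power2_eq_square power3_eq_cube)
  have "(deriv ^^ 3) (\<lambda>s::real. exp (- 2 * pi * s\<^sup>2)) t
     = (48 * pi\<^sup>2 * t - 64 * pi ^ 3 * t ^ 3) * exp (- 2 * pi * t\<^sup>2)"
    unfolding numeral_3_eq_3 funpow.simps o_apply id_apply 1 2 3 by simp
  moreover have "exp (pi * t\<^sup>2) * exp (- 2 * pi * t\<^sup>2) = exp (- pi * t\<^sup>2)"
    by (simp add: exp_add[symmetric])
  moreover have "(-1) ^ 3 * hermite_const 3 * e1 * ((48 * pi\<^sup>2 * t - 64 * pi ^ 3 * t ^ 3) * e2)
      = hermite_const 3 * 16 * pi\<^sup>2 * ((4 * pi * t ^ 3 - 3 * t) * (e1 * e2))" for e1 e2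
    by (simp add: algebra_simps power2_eq_square power3_eq_cube)
  ultimately show ?thesis unfolding hermite_fun_def by simp
qed

text \<open>Under the substitution both terms of 4 pi s^3 - 3 s acquire the common factor 3 sqrt 3,
  which leaves 4 pi t^3 - t; this explains 48 = 16 * 3.\<close>

lemma hermite_fun_3_sqrt_3:
  "hermite_fun 3 (sqrt 3 * t) = of_real (hermite_const 3 * 48 * pi\<^sup>2 * sqrt 3 * cubic_gaussian t)"
proof -
  have c: "(sqrt 3 * t) ^ 3 = 3 * sqrt 3 * t ^ 3" and q: "(sqrt 3 * t)\<^sup>2 = 3 * t\<^sup>2"
    by (simp_all add: power_mult_distrib power3_eq_cube)
  have "4 * pi * (sqrt 3 * t) ^ 3 - 3 * (sqrt 3 * t) = 3 * sqrt 3 * (4 * pi * t ^ 3 - t)"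
    unfolding c by (simp add: algebra_simps)
  moreover have "- pi * (sqrt 3 * t)\<^sup>2 = - 3 * pi * t\<^sup>2"
    unfolding q by simp
  ultimately show ?thesis
    unfolding hermite_fun_3 cubic_gaussian_def of_real_eq_iff by simp
qed

lemma inj_dilation:
  assumes "a > 0"
  shows "inj (dilation a)"
proof (rule injI, rule ext)
  fix f g t assume "dilation a f = dilation a g"
  from fun_cong[OF this, of "a * t"] show "f t = g t"
    using assms by (simp add: dilation_def)
qed

text \<open>Injectivity of the dilation determines the value of \<open>inv\<close> once a preimage
  is exhibited; the normalising factors cancel because sqrt (sqrt 3) = 3^(1/4).\<close>

lemma inv_dilation_sqrt_3:
  "inv (dilation (sqrt 3)) f = (\<lambda>t. of_real (3 powr (1/4)) * f (sqrt 3 * t))"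
proof (rule inv_f_eq)
  have "sqrt (sqrt 3) = 3 powr (1/4)"
    by (simp add: powr_half_sqrt[symmetric] powr_powr)
  then show "dilation (sqrt 3) (\<lambda>t. of_real (3 powr (1/4)) * f (sqrt 3 * t)) = f"
    by (auto simp: dilation_def fun_eq_iff simp flip: of_real_mult mult.assoc)
qed (simp add: inj_dilation)

section \<open>Density of the index set\<close>

lemma lattice_basis_standard:
  "lattice_basis (\<int> \<times> \<int>) (1, 0) (0, 1)"
proof -
  have "{(1, 0), (0, 1)} = (Basis :: (real \<times> real) set)"
    by (auto simp: Basis_prod_def)
  then have "independent {(1, 0), (0, 1 :: real) :: real \<times> real}"
    by (simp add: independent_Basis)
  then show ?thesis
    by (auto simp: lattice_basis_def elim!: Ints_cases)
qed

lemma measure_fundamental_cell_standard: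
  "measure lborel (fundamental_cell (1, 0) (0, 1)) = 1"
proof -
  have "fundamental_cell (1, 0) (0, 1) = {0..<1} \<times> {0..<1}"
    by (auto simp: fundamental_cell_def)
  moreover have "emeasure (lborel \<Otimes>\<^sub>M lborel) ({0..<1::real} \<times> {0..<1::real}) = 1"
    by (subst lborel.emeasure_pair_measure_Times) auto
  ultimately show ?thesis by (simp add: measure_def lborel_prod)
qed

text \<open>The set is the union of the \<open>N\<close> cosets of the integer lattice, of covolume
  1, through the points \<open>(x k, 0)\<close>.\<close>

lemma has_density_semi_regular:
  fixes x :: "nat \<Rightarrow> real"
  assumes "\<And>i. i \<in> {1..N} \<Longrightarrow> 0 \<le> x i \<and> x i < 1" and "inj_on x {1..N}"
  shows "has_density ((\<Union>k\<in>{1..N}. (\<lambda>m. m + x k) ` \<int>) \<times> \<int>) (real N)"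
  unfolding has_density_def
proof (intro exI conjI)
  show "lattice_basis (\<int> \<times> \<int>) (1, 0) (0, 1)" by (rule lattice_basis_standard)
  show "\<forall>i\<in>{1..N}. \<forall>j\<in>{1..N}. i \<noteq> j \<longrightarrow> (x i, 0) - (x j, 0) \<notin> \<int> \<times> (\<int> :: real set)"
  proof (intro ballI impI notI)
    fix i j assume ij: "i \<in> {1..N}" "j \<in> {1..N}" "i \<noteq> j"
      and "(x i, 0) - (x j, 0) \<in> \<int> \<times> (\<int> :: real set)"
    then obtain m :: int where m: "x i - x j = of_int m" by (auto elim!: Ints_cases)
    \<comment> \<open>Both points lie in [0, 1), so their difference lies strictly between -1 and
      1.\<close>
    then have "m = 0" using assms(1)[OF ij(1)] assms(1)[OF ij(2)] by linarith
    then show False using m inj_onD[OF assms(2), of i j] ij by simp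
  qed
  show "(\<Union>k\<in>{1..N}. (\<lambda>m. m + x k) ` \<int>) \<times> \<int> = (\<Union>m\<in>{1..N}. (\<lambda>l. l + (x m, 0)) ` (\<int> \<times> \<int>))"
    by (force simp: image_iff)
  show "real N = real N / measure lborel (fundamental_cell (1, 0) (0, 1))"
    by (simp add: measure_fundamental_cell_standard)
qed

theorem mainTheorem4:
  fixes x :: "nat \<Rightarrow> real" and g :: "real \<Rightarrow> complex" and \<Gamma> :: "nat \<Rightarrow> real set"
  assumes "g = inv (dilation (sqrt 3)) (hermite_fun 3)"
    and "x 1 = 0" and "x 2 = 1/3" and "x 3 = 1/2" and "x 4 = 2/3"
    and "\<And>N. \<Gamma> N = (\<Union>k\<in>{1..N}. (\<lambda>m. m + x k) ` \<int>)"
  shows "(\<forall>t. g t = complex_of_real (3 powr (1/4)) * hermite_fun 3 (sqrt 3 * t)) \<and>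
    (\<forall>N\<in>{2, 3, 4}.
       semi_regular_lattice (\<Gamma> N \<times> \<int>) \<and>
       has_density (\<Gamma> N \<times> \<int>) (real N) \<and>
       \<not> gabor_frame g (\<Gamma> N \<times> \<int>))"
proof (intro conjI ballI allI)
  show g: "g t = complex_of_real (3 powr (1/4)) * hermite_fun 3 (sqrt 3 * t)" for t
    by (simp add: assms(1) inv_dilation_sqrt_3)
  fix N :: nat assume N: "N \<in> {2, 3, 4}"
  have x: "i = 1 \<and> x i = 0 \<or> i = 2 \<and> x i = 1/3 \<or> i = 3 \<and> x i = 1/2 \<or> i = 4 \<and> x i = 2/3"
    if "i \<in> {1..N}" for i
  proof -
    have "i = 1 \<or> i = 2 \<or> i = 3 \<or> i = 4" using that N by auto
    then show ?thesis using assms(2-5) by blast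
  qed
  show "semi_regular_lattice (\<Gamma> N \<times> \<int>)" by (auto simp: semi_regular_lattice_def)
  show "has_density (\<Gamma> N \<times> \<int>) (real N)"
    unfolding assms(6)
  proof (rule has_density_semi_regular)
    show "0 \<le> x i \<and> x i < 1" if "i \<in> {1..N}" for i using x[OF that] by auto
    show "inj_on x {1..N}"
    proof (rule inj_onI)
      fix i j assume "i \<in> {1..N}" "j \<in> {1..N}" "x i = x j"
      then show "i = j" using x[of i] x[of j] by auto
    qed
  qed
  \<comment> \<open>The constant gathers all scalar factors, so that \<open>g\<close> is a multiple
    of the cubic Gaussian and inherits the zeros of its periodization.\<close>
  define c where "c = 3 powr (1/4) * (hermite_const 3 * 48 * pi\<^sup>2 * sqrt 3)"
  have gc: "g = (\<lambda>t. of_real (c * cubic_gaussian t))"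
    by (auto simp: g hermite_fun_3_sqrt_3 c_def)
  let ?P = "periodization cubic_gaussian"
  have odd: "?P (- u) = - ?P u" for u
    by (rule periodization_minus_of_odd) (rule cubic_gaussian_minus)
  \<comment> \<open>Oddness gives the zero at 0; the points 1/2 and -1/2 differ by a period, so
    oddness also gives a zero there; -1/3 is the reflection of 1/3, and -2/3 is 1/3 minus a
    period.\<close>
  have "?P 0 = 0" using odd[of 0] by simp
  moreover have "?P (- (1/3)) = 0" using odd[of "1/3"] periodization_cubic_gaussian_third by simp
  moreover have "?P (- (1/2)) = 0"
    using odd[of "1/2"] periodization_add_int[of cubic_gaussian "- (1/2)" 1] by simp
  moreover have "?P (- (2/3)) = 0"
    using periodization_cubic_gaussian_third periodization_add_int[of cubic_gaussian "- (2/3)" 1] by simp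
  ultimately have "?P (- x i) = 0" if "i \<in> {1..N}" for i
    using x[OF that] by (elim disjE conjE) (simp_all only: minus_zero)
  then have "\<not> gabor_frame g ((\<Union>y\<in>x ` {1..N}. (\<lambda>m. m + y) ` \<int>) \<times> \<int>)"
    unfolding gc
    by (intro not_gabor_frame_if_periodization_zero exp_decay_of_real exp_decay_cubic_gaussian)
      (auto simp: periodization_of_real exp_decay_cubic_gaussian
        intro!: continuous_intros continuous_on_cubic_gaussian simp del: of_real_mult)
  then show "\<not> gabor_frame g (\<Gamma> N \<times> \<int>)"
    by (simp add: assms(6))
qed

end
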